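(* Let $G$ be a diffeological group and let $\mathbb Z_2=\{\pm1\}$ act on $E^{\mathrm{sph}}(G)$ by $\varepsilon\cdot[(x_i,g_i)]=[(\varepsilon x_i,g_i)]$. The quotient map $\pi:E^{\mathrm{sph}}(G)\to E^{\mathrm{proj}}(G)=E^{\mathrm{sph}}(G)/\mathbb Z_2$ defines a principal $\mathbb Z_2$-bundle in the diffeological sense. Consequently, it determines a canonical characteristic class $\alpha_{\mathrm{sph}}\in H^1(E^{\mathrm{proj}}(G);\mathbb Z_2)$.
   Context: Let $\widetilde E^{\mathrm{sph}}(G)$ be the set of families $(x_i,g_i)_{i\in\mathbb N}$ with $x_i\in\mathbb R$, $g_i\in G$, only finitely many $x_i$ nonzero, and $\sum_i x_i^2=1$. Define $(x_i,g_i)\sim(x_i,g_i')$ iff $g_i=g_i'$ for every $i$ with $x_i\neq 0$ (the coordinates $x_i$ being the same), and $E^{\mathrm{sph}}(G)=\widetilde E^{\mathrm{sph}}(G)/\sim$; classes are written $[(x_i,g_i)]$. For each finite $I\subset\mathbb N$ let $S_I=\{(x_i)_{i\in I}\in\mathbb R^I: \sum_{i\in I}x_i^2=1\}$ with the subset diffeology from $\mathbb R^I$, and let $\psi_I:S_I\times G^I\to E^{\mathrm{sph}}(G)$ send $(x_i,g_i)_{i\in I}$ to the class of the family extended by $x_i=0$ for $i\notin I$ (labels outside $I$ are irrelevant). $E^{\mathrm{sph}}(G)$ carries the final diffeology of the family $(\psi_I)_I$, i.e. the finest diffeology making all $\psi_I$ smooth. $E^{\mathrm{proj}}(G)$ carries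 the quotient diffeology. A quotient map $\pi:E\to E/H$ by a smooth free action of a diffeological group $H$ is a principal $H$-bundle in the diffeological sense if the map $E\times H\to E\times_{E/H}E$, sending $(p,h)$ to the pair formed by $p$ and its translate by $h$, is a diffeomorphism. The characteristic class of a principal $\mathbb Z_2$-bundle is the Čech class (for the $D$-topology of the base) of the cocycle $(g_{ab})$, where $(U_a)$ is a $D$-open cover with smooth local sections $s_a$ and $g_{ab}:U_a\cap U_b\to\mathbb Z_2$ is the locally constant function with $s_b=g_{ab}\cdot s_a$. *)

theory Defs
  imports "HOL-Analysis.Abstract_Euclidean_Space" "HOL-Algebra.Group_Action"
begin

section \<open>Smooth maps between open subsets of the spaces R^n\<close>

text \<open>
  R^n is the library's \<^term>\<open>Euclidean_space n\<close>, carried by the sequences that vanish from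
  index n on, so that one type contains all dimensions. For a set U open in R^n, the predicate
  \<open>C_diff k n U f\<close> says that all partial derivatives of f of order at most k exist
  and are continuous on U. Values of f outside U are irrelevant.
\<close>

primrec C_diff :: "nat \<Rightarrow> nat \<Rightarrow> (nat \<Rightarrow> real) set \<Rightarrow> ((nat \<Rightarrow> real) \<Rightarrow> real) \<Rightarrow> bool" where
  "C_diff 0 n U f \<longleftrightarrow> continuous_map (subtopology (Euclidean_space n) U) euclideanreal f"
| "C_diff (Suc k) n U f \<longleftrightarrow>
     continuous_map (subtopology (Euclidean_space n) U) euclideanreal f \<and>
     (\<forall>i<n. \<exists>g. (\<forall>u\<in>U. ((\<lambda>t. f (u(i := t))) has_real_derivative g u) (at (u i))) \<and>
                C_diff k n U g)"

definition smooth_fun :: "nat \<Rightarrow> (nat \<Rightarrow> real) set \<Rightarrow> ((nat \<Rightarrow> real) \<Rightarrow> real) \<Rightarrow> bool" where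
  "smooth_fun n U f \<longleftrightarrow> (\<forall>k. C_diff k n U f)"

definition smooth_between ::
  "nat \<Rightarrow> (nat \<Rightarrow> real) set \<Rightarrow> nat \<Rightarrow> (nat \<Rightarrow> real) set \<Rightarrow> ((nat \<Rightarrow> real) \<Rightarrow> (nat \<Rightarrow> real)) \<Rightarrow> bool" where
  "smooth_between m V n U F \<longleftrightarrow> F \<in> V \<rightarrow> U \<and> (\<forall>i<n. smooth_fun m V (\<lambda>v. F v i))"


section \<open>Diffeological spaces\<close>

text \<open>\<open>plot X n U p\<close>: the restriction of p to U, an open subset of R^n, is a plot of X.\<close>

record 'a dspace =
  pts :: "'a set"
  plot :: "nat \<Rightarrow> (nat \<Rightarrow> real) set \<Rightarrow> ((nat \<Rightarrow> real) \<Rightarrow> 'a) \<Rightarrow> bool"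

text \<open>
  The second clause makes plots insensitive to values outside the domain; the last three are
  the covering, locality and smooth compatibility axioms.
\<close>

definition diffeological_space :: "'a dspace \<Rightarrow> bool" where
  "diffeological_space X \<longleftrightarrow>
     (\<forall>n U p. plot X n U p \<longrightarrow> openin (Euclidean_space n) U \<and> p \<in> U \<rightarrow> pts X) \<and>
     (\<forall>n U p q. plot X n U p \<longrightarrow> (\<forall>u\<in>U. p u = q u) \<longrightarrow> plot X n U q) \<and>
     (\<forall>n U. \<forall>x\<in>pts X. openin (Euclidean_space n) U \<longrightarrow> plot X n U (\<lambda>_. x)) \<and>
     (\<forall>n U p. openin (Euclidean_space n) U \<longrightarrow>
        (\<forall>u\<in>U. \<exists>V. u \<in> V \<and> V \<subseteq> U \<and> plot X n V p) \<longrightarrow> plot X n U p) \<and>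
     (\<forall>n U p m V F. plot X n U p \<longrightarrow> openin (Euclidean_space m) V \<longrightarrow>
        smooth_between m V n U F \<longrightarrow> plot X m V (p \<circ> F))"

definition smooth_map :: "'a dspace \<Rightarrow> 'b dspace \<Rightarrow> ('a \<Rightarrow> 'b) \<Rightarrow> bool" where
  "smooth_map X Y f \<longleftrightarrow>
     f \<in> pts X \<rightarrow> pts Y \<and> (\<forall>n U p. plot X n U p \<longrightarrow> plot Y n U (f \<circ> p))"

definition diffeomorphism :: "'a dspace \<Rightarrow> 'b dspace \<Rightarrow> ('a \<Rightarrow> 'b) \<Rightarrow> bool" where
  "diffeomorphism X Y f \<longleftrightarrow>
     bij_betw f (pts X) (pts Y) \<and> smooth_map X Y f \<and> smooth_map Y X (inv_into (pts X) f)"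

definition real_dspace :: "real dspace" where
  "real_dspace = \<lparr>pts = UNIV, plot = (\<lambda>n U p. openin (Euclidean_space n) U \<and> smooth_fun n U p)\<rparr>"

definition discrete_dspace :: "'a set \<Rightarrow> 'a dspace" where
  "discrete_dspace A =
     \<lparr>pts = A,
      plot = (\<lambda>n U p. openin (Euclidean_space n) U \<and>
                continuous_map (subtopology (Euclidean_space n) U) (discrete_topology A) p)\<rparr>"

definition subset_dspace :: "'a dspace \<Rightarrow> 'a set \<Rightarrow> 'a dspace" where
  "subset_dspace X A =
     \<lparr>pts = pts X \<inter> A, plot = (\<lambda>n U p. plot X n U p \<and> p \<in> U \<rightarrow> A)\<rparr>"

definition prod_dspace :: "'a dspace \<Rightarrow> 'b dspace \<Rightarrow> ('a \<times> 'b) dspace" where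
  "prod_dspace X Y =
     \<lparr>pts = pts X \<times> pts Y,
      plot = (\<lambda>n U p. plot X n U (fst \<circ> p) \<and> plot Y n U (snd \<circ> p))\<rparr>"

definition power_dspace :: "'i set \<Rightarrow> 'a dspace \<Rightarrow> ('i \<Rightarrow> 'a) dspace" where
  "power_dspace I X =
     \<lparr>pts = I \<rightarrow>\<^sub>E pts X,
      plot = (\<lambda>n U p. openin (Euclidean_space n) U \<and> p \<in> U \<rightarrow> (I \<rightarrow>\<^sub>E pts X) \<and>
                (\<forall>i\<in>I. plot X n U (\<lambda>u. p u i)))\<rparr>"

text \<open>
  The finest diffeology on Y for which all f i are smooth: its plots are those common to every
  diffeology on Y with this property.
\<close>

definition final_dspace ::
  "'b set \<Rightarrow> 'i set \<Rightarrow> ('i \<Rightarrow> 'a dspace) \<Rightarrow> ('i \<Rightarrow> 'a \<Rightarrow> 'b) \<Rightarrow> 'b dspace" where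
  "final_dspace Y I X f =
     \<lparr>pts = Y,
      plot = (\<lambda>n U p. \<forall>Z. diffeological_space Z \<and> pts Z = Y \<and> (\<forall>i\<in>I. smooth_map (X i) Z (f i))
                \<longrightarrow> plot Z n U p)\<rparr>"

definition D_topology :: "'a dspace \<Rightarrow> 'a topology" where
  "D_topology X = topology (\<lambda>A. A \<subseteq> pts X \<and>
     (\<forall>n U p. plot X n U p \<longrightarrow> openin (Euclidean_space n) {u \<in> U. p u \<in> A}))"

lemma openin_D_topology:
  "openin (D_topology X) A \<longleftrightarrow> A \<subseteq> pts X \<and>
     (\<forall>n U p. plot X n U p \<longrightarrow> openin (Euclidean_space n) {u \<in> U. p u \<in> A})"
proof -
  have "istopology (\<lambda>A. A \<subseteq> pts X \<and>
     (\<forall>n U p. plot X n U p \<longrightarrow> openin (Euclidean_space n) {u \<in> U. p u \<in> A}))"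
    unfolding istopology_def
  proof (intro conjI allI impI)
    fix S T n U p
    assume S: "S \<subseteq> pts X \<and> (\<forall>n U p. plot X n U p \<longrightarrow> openin (Euclidean_space n) {u \<in> U. p u \<in> S})"
      and T: "T \<subseteq> pts X \<and> (\<forall>n U p. plot X n U p \<longrightarrow> openin (Euclidean_space n) {u \<in> U. p u \<in> T})"
    show "S \<inter> T \<subseteq> pts X" using S by blast
    assume "plot X n U p"
    with S T have "openin (Euclidean_space n) ({u \<in> U. p u \<in> S} \<inter> {u \<in> U. p u \<in> T})"
      by blast
    also have "{u \<in> U. p u \<in> S} \<inter> {u \<in> U. p u \<in> T} = {u \<in> U. p u \<in> S \<inter> T}" by blast
    finally show "openin (Euclidean_space n) {u \<in> U. p u \<in> S \<inter> T}" .
  next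
    fix \<K> n U p
    assume K: "\<forall>K\<in>\<K>. K \<subseteq> pts X \<and>
      (\<forall>n U p. plot X n U p \<longrightarrow> openin (Euclidean_space n) {u \<in> U. p u \<in> K})"
    show "\<Union>\<K> \<subseteq> pts X" using K by blast
    assume "plot X n U p"
    with K have "openin (Euclidean_space n) (\<Union>K\<in>\<K>. {u \<in> U. p u \<in> K})"
      by blast
    also have "(\<Union>K\<in>\<K>. {u \<in> U. p u \<in> K}) = {u \<in> U. p u \<in> \<Union>\<K>}" by blast
    finally show "openin (Euclidean_space n) {u \<in> U. p u \<in> \<Union>\<K>}" .
  qed
  then show ?thesis
    unfolding D_topology_def by (simp add: topology_inverse')
qed


section \<open>Diffeological groups and principal bundles\<close>

definition diffeological_group :: "('g, 'm) monoid_scheme \<Rightarrow> 'g dspace \<Rightarrow> bool" where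
  "diffeological_group G D \<longleftrightarrow>
     group G \<and> diffeological_space D \<and> pts D = carrier G \<and>
     smooth_map (prod_dspace D D) D (\<lambda>(g, h). g \<otimes>\<^bsub>G\<^esub> h) \<and>
     smooth_map D D (\<lambda>g. inv\<^bsub>G\<^esub> g)"

definition smooth_free_action ::
  "('h, 'm) monoid_scheme \<Rightarrow> 'h dspace \<Rightarrow> 'e dspace \<Rightarrow> ('h \<Rightarrow> 'e \<Rightarrow> 'e) \<Rightarrow> bool" where
  "smooth_free_action H DH E \<phi> \<longleftrightarrow>
     group_action H (pts E) \<phi> \<and>
     smooth_map (prod_dspace DH E) E (\<lambda>(h, p). \<phi> h p) \<and>
     (\<forall>p\<in>pts E. stabilizer H \<phi> p = {\<one>\<^bsub>H\<^esub>})"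

text \<open>The projection E \<open>\<rightarrow>\<close> E/H is \<^term>\<open>orbit H \<phi>\<close>; E/H carries the quotient diffeology.\<close>

definition quotient_dspace ::
  "('h, 'm) monoid_scheme \<Rightarrow> 'e dspace \<Rightarrow> ('h \<Rightarrow> 'e \<Rightarrow> 'e) \<Rightarrow> 'e set dspace" where
  "quotient_dspace H E \<phi> =
     final_dspace (orbits H (pts E) \<phi>) {()} (\<lambda>_. E) (\<lambda>_. orbit H \<phi>)"

definition fibre_product ::
  "('h, 'm) monoid_scheme \<Rightarrow> 'e dspace \<Rightarrow> ('h \<Rightarrow> 'e \<Rightarrow> 'e) \<Rightarrow> ('e \<times> 'e) dspace" where
  "fibre_product H E \<phi> =
     subset_dspace (prod_dspace E E) {(p, q). orbit H \<phi> p = orbit H \<phi> q}"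

definition principal_bundle ::
  "('h, 'm) monoid_scheme \<Rightarrow> 'h dspace \<Rightarrow> 'e dspace \<Rightarrow> ('h \<Rightarrow> 'e \<Rightarrow> 'e) \<Rightarrow> bool" where
  "principal_bundle H DH E \<phi> \<longleftrightarrow>
     diffeological_group H DH \<and> diffeological_space E \<and> smooth_free_action H DH E \<phi> \<and>
     diffeomorphism (prod_dspace E DH) (fibre_product H E \<phi>) (\<lambda>(p, h). (p, \<phi> h p))"


section \<open>First Cech cohomology\<close>

text \<open>
  Coefficients are the locally constant functions with values in an abelian group H. Families
  over a cover are triples (I, U, g) of an index set, the open sets and the functions on the
  pairwise intersections; values of U, g outside their domains are irrelevant.
\<close>

definition open_cover :: "'x topology \<Rightarrow> 'i set \<Rightarrow> ('i \<Rightarrow> 'x set) \<Rightarrow> bool" where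
  "open_cover T I U \<longleftrightarrow> (\<forall>a\<in>I. openin T (U a)) \<and> (\<Union>a\<in>I. U a) = topspace T"

definition locally_constant :: "'x topology \<Rightarrow> 'h set \<Rightarrow> 'x set \<Rightarrow> ('x \<Rightarrow> 'h) \<Rightarrow> bool" where
  "locally_constant T A U f \<longleftrightarrow> continuous_map (subtopology T U) (discrete_topology A) f"

type_synonym ('i, 'x, 'h) cech_family =
  "'i set \<times> ('i \<Rightarrow> 'x set) \<times> ('i \<Rightarrow> 'i \<Rightarrow> 'x \<Rightarrow> 'h)"

definition cech_cocycle ::
  "'x topology \<Rightarrow> ('h, 'm) monoid_scheme \<Rightarrow> ('i, 'x, 'h) cech_family \<Rightarrow> bool" where
  "cech_cocycle T H = (\<lambda>(I, U, g).
     open_cover T I U \<and>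
     (\<forall>a\<in>I. \<forall>b\<in>I. locally_constant T (carrier H) (U a \<inter> U b) (g a b)) \<and>
     (\<forall>a\<in>I. \<forall>b\<in>I. \<forall>c\<in>I. \<forall>x\<in>U a \<inter> U b \<inter> U c. g a b x \<otimes>\<^bsub>H\<^esub> g b c x = g a c x))"

text \<open>On one cover: h equals g times the coboundary of a 0-cochain c.\<close>

definition cech_cohomologous ::
  "'x topology \<Rightarrow> ('h, 'm) monoid_scheme \<Rightarrow> 'i set \<Rightarrow> ('i \<Rightarrow> 'x set) \<Rightarrow>
     ('i \<Rightarrow> 'i \<Rightarrow> 'x \<Rightarrow> 'h) \<Rightarrow> ('i \<Rightarrow> 'i \<Rightarrow> 'x \<Rightarrow> 'h) \<Rightarrow> bool" where
  "cech_cohomologous T H I U g h \<longleftrightarrow>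
     (\<exists>c. (\<forall>a\<in>I. locally_constant T (carrier H) (U a) (c a)) \<and>
          (\<forall>a\<in>I. \<forall>b\<in>I. \<forall>x\<in>U a \<inter> U b.
             h a b x = g a b x \<otimes>\<^bsub>H\<^esub> (c b x \<otimes>\<^bsub>H\<^esub> inv\<^bsub>H\<^esub> (c a x))))"

definition refinement ::
  "'k set \<Rightarrow> ('k \<Rightarrow> 'x set) \<Rightarrow> 'i set \<Rightarrow> ('i \<Rightarrow> 'x set) \<Rightarrow> ('k \<Rightarrow> 'i) \<Rightarrow> bool" where
  "refinement K W I U r \<longleftrightarrow> r \<in> K \<rightarrow> I \<and> (\<forall>k\<in>K. W k \<subseteq> U (r k))"

text \<open>
  Two cocycles represent the same element of the direct limit over all open covers iff their
  pullbacks to some common refinement are cohomologous. The refining cover is indexed by sets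
  of points, which is no restriction: a cover can be indexed by its own members.
\<close>

definition cech_equiv ::
  "'x topology \<Rightarrow> ('h, 'm) monoid_scheme \<Rightarrow>
     ('i, 'x, 'h) cech_family \<Rightarrow> ('j, 'x, 'h) cech_family \<Rightarrow> bool" where
  "cech_equiv T H = (\<lambda>(I, U, g) (J, V, h).
     cech_cocycle T H (I, U, g) \<and> cech_cocycle T H (J, V, h) \<and>
     (\<exists>(K :: 'x set set) W r t.
        open_cover T K W \<and> refinement K W I U r \<and> refinement K W J V t \<and>
        cech_cohomologous T H K W (\<lambda>k l. g (r k) (r l)) (\<lambda>k l. h (t k) (t l))))"

text \<open>
  The (underlying set of the) direct limit is formed from covers indexed by sets of points;
  \<open>cech_class\<close> assigns an element of it to a cocycle on a cover with an arbitrary index set.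
\<close>

definition cech_H1 ::
  "'x topology \<Rightarrow> ('h, 'm) monoid_scheme \<Rightarrow> ('x set, 'x, 'h) cech_family set set" where
  "cech_H1 T H = {C. cech_cocycle T H C} // {(C, C'). cech_equiv T H C C'}"

definition cech_class ::
  "'x topology \<Rightarrow> ('h, 'm) monoid_scheme \<Rightarrow> ('i, 'x, 'h) cech_family \<Rightarrow>
     ('x set, 'x, 'h) cech_family set" where
  "cech_class T H C = {C'. cech_equiv T H C C'}"


section \<open>The characteristic class of a principal bundle with abelian structure group\<close>

definition local_sections ::
  "('h, 'm) monoid_scheme \<Rightarrow> 'e dspace \<Rightarrow> ('h \<Rightarrow> 'e \<Rightarrow> 'e) \<Rightarrow>
     'i set \<Rightarrow> ('i \<Rightarrow> 'e set set) \<Rightarrow> ('i \<Rightarrow> 'e set \<Rightarrow> 'e) \<Rightarrow> bool" where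
  "local_sections H E \<phi> I U s \<longleftrightarrow>
     open_cover (D_topology (quotient_dspace H E \<phi>)) I U \<and>
     (\<forall>a\<in>I. smooth_map (subset_dspace (quotient_dspace H E \<phi>) (U a)) E (s a) \<and>
            (\<forall>x\<in>U a. orbit H \<phi> (s a x) = x))"

definition transition_functions ::
  "('h, 'm) monoid_scheme \<Rightarrow> ('h \<Rightarrow> 'e \<Rightarrow> 'e) \<Rightarrow> 'i set \<Rightarrow> ('i \<Rightarrow> 'e set set) \<Rightarrow>
     ('i \<Rightarrow> 'e set \<Rightarrow> 'e) \<Rightarrow> ('i \<Rightarrow> 'i \<Rightarrow> 'e set \<Rightarrow> 'h) \<Rightarrow> bool" where
  "transition_functions H \<phi> I U s g \<longleftrightarrow>
     (\<forall>a\<in>I. \<forall>b\<in>I. \<forall>x\<in>U a \<inter> U b. g a b x \<in> carrier H \<and> s b x = \<phi> (g a b x) (s a x))"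

text \<open>
  The element \<open>\<alpha>\<close> is represented by the cocycle of every system of local sections indexed by a
  subset of the type \<open>'i\<close>; in particular these cocycles exist.
\<close>

definition is_characteristic_class ::
  "'i itself \<Rightarrow> ('h, 'm) monoid_scheme \<Rightarrow> 'e dspace \<Rightarrow> ('h \<Rightarrow> 'e \<Rightarrow> 'e) \<Rightarrow>
     ('e set set, 'e set, 'h) cech_family set \<Rightarrow> bool" where
  "is_characteristic_class (ty :: 'i itself) H E \<phi> \<alpha> \<longleftrightarrow>
     \<alpha> \<in> cech_H1 (D_topology (quotient_dspace H E \<phi>)) H \<and>
     (\<forall>(I :: 'i set) U s. local_sections H E \<phi> I U s \<longrightarrow>
        (\<exists>g. transition_functions H \<phi> I U s g) \<and>
        (\<forall>g. transition_functions H \<phi> I U s g \<longrightarrow>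
           cech_cocycle (D_topology (quotient_dspace H E \<phi>)) H (I, U, g) \<and>
           cech_class (D_topology (quotient_dspace H E \<phi>)) H (I, U, g) = \<alpha>))"

definition characteristic_class ::
  "('h, 'm) monoid_scheme \<Rightarrow> 'e dspace \<Rightarrow> ('h \<Rightarrow> 'e \<Rightarrow> 'e) \<Rightarrow>
     ('e set set, 'e set, 'h) cech_family set" where
  "characteristic_class H E \<phi> = (THE \<alpha>. is_characteristic_class TYPE('e set set) H E \<phi> \<alpha>)"


section \<open>The spherical space of a diffeological group\<close>

text \<open>A family \<open>(x_i, g_i)\<close> is encoded as the pair of the families \<open>(x_i)\<close> and \<open>(g_i)\<close>.\<close>

type_synonym 'g sph_family = "(nat \<Rightarrow> real) \<times> (nat \<Rightarrow> 'g)"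

definition sph_families :: "('g, 'm) monoid_scheme \<Rightarrow> 'g sph_family set" where
  "sph_families G =
     {(x, g). finite {i. x i \<noteq> 0} \<and> (\<Sum>i | x i \<noteq> 0. (x i)\<^sup>2) = 1 \<and> (\<forall>i. g i \<in> carrier G)}"

definition sph_rel :: "('g, 'm) monoid_scheme \<Rightarrow> ('g sph_family \<times> 'g sph_family) set" where
  "sph_rel G =
     {((x, g), (x', g')). (x, g) \<in> sph_families G \<and> (x', g') \<in> sph_families G \<and>
        x = x' \<and> (\<forall>i. x i \<noteq> 0 \<longrightarrow> g i = g' i)}"

definition E_sph_set :: "('g, 'm) monoid_scheme \<Rightarrow> 'g sph_family set set" where
  "E_sph_set G = sph_families G // sph_rel G"

definition sph_class :: "('g, 'm) monoid_scheme \<Rightarrow> 'g sph_family \<Rightarrow> 'g sph_family set" where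
  "sph_class G v = sph_rel G `` {v}"

definition sphere_dspace :: "nat set \<Rightarrow> (nat \<Rightarrow> real) dspace" where
  "sphere_dspace I = subset_dspace (power_dspace I real_dspace) {x. (\<Sum>i\<in>I. (x i)\<^sup>2) = 1}"

definition \<psi> ::
  "('g, 'm) monoid_scheme \<Rightarrow> nat set \<Rightarrow> (nat \<Rightarrow> real) \<times> (nat \<Rightarrow> 'g) \<Rightarrow> 'g sph_family set" where
  "\<psi> G I = (\<lambda>(x, g). sph_class G
     (\<lambda>i. if i \<in> I then x i else 0, \<lambda>i. if i \<in> I then g i else \<one>\<^bsub>G\<^esub>))"

definition E_sph :: "('g, 'm) monoid_scheme \<Rightarrow> 'g dspace \<Rightarrow> 'g sph_family set dspace" where
  "E_sph G D = final_dspace (E_sph_set G) {I. finite I}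
     (\<lambda>I. prod_dspace (sphere_dspace I) (power_dspace I D)) (\<psi> G)"

definition Z2 :: "int monoid" where
  "Z2 = \<lparr>carrier = {1, -1}, monoid.mult = (*), one = 1\<rparr>"

text \<open>
  The union only removes the choice of a representative. The action is extensional because
  this is what \<^locale>\<open>group_action\<close> requires.
\<close>

definition sph_act ::
  "('g, 'm) monoid_scheme \<Rightarrow> int \<Rightarrow> 'g sph_family set \<Rightarrow> 'g sph_family set" where
  "sph_act G \<epsilon> =
     (\<lambda>c\<in>E_sph_set G. \<Union>(x, g)\<in>c. sph_class G (\<lambda>i. real_of_int \<epsilon> * x i, g))"

definition E_proj :: "('g, 'm) monoid_scheme \<Rightarrow> 'g dspace \<Rightarrow> 'g sph_family set set dspace" where
  "E_proj G D = quotient_dspace Z2 (E_sph G D) (sph_act G)"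

definition alpha_sph ::
  "('g, 'm) monoid_scheme \<Rightarrow> 'g dspace \<Rightarrow>
     ('g sph_family set set set, 'g sph_family set set, int) cech_family set" where
  "alpha_sph G D = characteristic_class Z2 (E_sph G D) (sph_act G)"

end

theory Submission
  imports Defs
begin

text \<open>
  The coordinates \<open>x_i\<close> are well-defined functions on the spherical space, and the nontrivial element of
  Z2 changes all their signs. By the universal property of the final diffeology this action is smooth
  (\<open>smooth_sph_act\<close>) and each \<open>x_i\<close> is continuous along plots (\<open>continuous_sph_coord\<close>). Since the
  squares sum to 1, some \<open>x_i\<close> is nonzero at every point. Everything else about the bundle follows from
  these facts.

  The action is free, because a sign that fixes a point fixes a nonzero coordinate. If two plots p and q
  satisfy \<open>q = h p\<close> with signs h, then h is locally constant, since it is the sign of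
  \<open>x_i(p) x_i(q)\<close> wherever \<open>x_i\<close> does not vanish (\<open>plot_sign\<close>). For a free smooth action of a discrete
  group this is smoothness of the inverse of \<open>(p, h) \<mapsto> (p, h p)\<close>, that is, the bundle condition
  (\<open>principal_bundle_discreteI\<close>). As for local sections, the orbits on which \<open>x_i\<close> does not vanish form a
  D-open set, on which the representative with \<open>x_i > 0\<close> is a section. It is smooth because plots of a
  quotient lift locally (\<open>plot_final_surj_lift\<close>) and the sign of \<open>x_i\<close> is locally constant along the
  lift (\<open>smooth_section_positive_lift\<close>).

  The characteristic class exists for every principal bundle with discrete abelian structure group and
  local sections. Transition functions are locally constant because the inverse above is smooth
  (\<open>locally_constant_transition\<close>), two systems of sections differ by a locally constant 0-cochain on the
  common refinement of their covers (\<open>cech_equiv_transition\<close>), and equivalence of cocycles is transitive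
  across index types (\<open>cech_equiv_trans\<close>). So all systems of sections, whatever their index type, give
  one class.
\<close>

section \<open>Continuity on open subsets\<close>

lemma continuous_map_open_subtopology_iff:
  assumes "openin T U"
  shows "continuous_map (subtopology T U) Y f \<longleftrightarrow>
    f \<in> U \<rightarrow> topspace Y \<and> (\<forall>S. openin Y S \<longrightarrow> openin T {x \<in> U. f x \<in> S})"
proof -
  have "topspace (subtopology T U) = U"
    using assms by (simp add: Int_absorb1 openin_subset)
  moreover have "{x \<in> U. f x \<in> S} \<subseteq> U" for S by blast
  ultimately show ?thesis
    using assms unfolding continuous_map_def by (simp only: openin_open_subtopology) simp
qed

lemma continuous_map_open_discrete_iff:
  assumes "openin T U"
  shows "continuous_map (subtopology T U) (discrete_topology A) f \<longleftrightarrow>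
    f \<in> U \<rightarrow> A \<and> (\<forall>a\<in>A. openin T {x \<in> U. f x = a})"
proof -
  have "openin T {x \<in> U. f x \<in> S}"
    if "S \<subseteq> A" "\<forall>a\<in>A. openin T {x \<in> U. f x = a}" for S
  proof -
    have "openin T (\<Union>a\<in>S. {x \<in> U. f x = a})" using that by blast
    moreover have "(\<Union>a\<in>S. {x \<in> U. f x = a}) = {x \<in> U. f x \<in> S}" by blast
    ultimately show ?thesis by simp
  qed
  moreover have "openin T {x \<in> U. f x = a}"
    if "\<forall>S. S \<subseteq> A \<longrightarrow> openin T {x \<in> U. f x \<in> S}" "a \<in> A" for a
    using that(1)[rule_format, of "{a}"] that(2) by simp
  ultimately show ?thesis
    unfolding continuous_map_open_subtopology_iff[OF assms] by auto
qed


section \<open>Smooth functions on open subsets of the spaces R^n\<close>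

lemma C_diff_continuous:
  "C_diff k n U f \<Longrightarrow> continuous_map (subtopology (Euclidean_space n) U) euclideanreal f"
  by (cases k) auto

lemma C_diff_subset:
  assumes "C_diff k n U f" "V \<subseteq> U"
  shows "C_diff k n V f"
  using assms
proof (induction k arbitrary: f)
  case 0
  then show ?case by (auto intro: continuous_map_from_subtopology_mono)
next
  case (Suc k)
  then show ?case
    by simp (metis continuous_map_from_subtopology_mono subsetD)
qed

lemma C_diff_const: "C_diff k n U (\<lambda>_. c)"
proof (induction k arbitrary: c)
  case (Suc k)
  have "((\<lambda>t. c) has_real_derivative 0) (at x)" for x by simp
  then show ?case using Suc[of 0] by (auto intro!: exI[of _ "\<lambda>_. 0"])
qed simp

lemma C_diff_minus: "C_diff k n U f \<Longrightarrow> C_diff k n U (\<lambda>u. - f u)"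
proof (induction k arbitrary: f)
  case 0
  then show ?case by (simp add: continuous_map_minus)
next
  case (Suc k)
  have "\<exists>g. (\<forall>u\<in>U. ((\<lambda>t. - f (u(i := t))) has_real_derivative g u) (at (u i))) \<and> C_diff k n U g"
    if "i < n" for i
  proof -
    obtain g where "\<forall>u\<in>U. ((\<lambda>t. f (u(i := t))) has_real_derivative g u) (at (u i))"
      "C_diff k n U g"
      using Suc.prems \<open>i < n\<close> by auto
    then show ?thesis
      using Suc.IH by (intro exI[of _ "\<lambda>u. - g u"]) (auto intro: DERIV_minus)
  qed
  then show ?case using Suc.prems by (simp add: continuous_map_minus)
qed

lemma continuous_map_coordinate:
  "continuous_map (subtopology (Euclidean_space n) U) euclideanreal (\<lambda>u. u i)"
  unfolding Euclidean_space_def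
  by (intro continuous_map_from_subtopology continuous_map_product_projection) auto

lemma C_diff_coordinate: "C_diff k n U (\<lambda>u. u i)"
proof (cases k)
  case (Suc l)
  have "((\<lambda>t. (u(j := t)) i) has_real_derivative (if i = j then 1 else 0)) (at (u j))"
    for u :: "nat \<Rightarrow> real" and j
    by auto
  then have "\<exists>g. (\<forall>u\<in>U. ((\<lambda>t. (u(j := t)) i) has_real_derivative g u) (at (u j))) \<and> C_diff l n U g" for j
    using C_diff_const by (intro exI[of _ "\<lambda>_. if i = j then 1 else 0"]) blast
  then show ?thesis
    using Suc continuous_map_coordinate by simp
qed (simp add: continuous_map_coordinate)

lemma smooth_between_inclusion:
  assumes "V \<subseteq> U"
  shows "smooth_between n V n U (\<lambda>v. v)"
  using assms C_diff_coordinate by (auto simp: smooth_between_def smooth_fun_def)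

lemma smooth_between_restrict:
  assumes "smooth_between m V n U F" "V' \<subseteq> V" "F \<in> V' \<rightarrow> U'"
  shows "smooth_between m V' n U' F"
  using assms C_diff_subset unfolding smooth_between_def smooth_fun_def by blast

lemma smooth_between_continuous:
  assumes "smooth_between m V n U F" "openin (Euclidean_space n) U"
  shows "continuous_map (subtopology (Euclidean_space m) V) (Euclidean_space n) F"
proof -
  have zero: "F v i = 0" if "v \<in> V" "n \<le> i" for v i
  proof -
    have "F v \<in> topspace (Euclidean_space n)"
      using assms(1) that(1) openin_subset[OF assms(2)] unfolding smooth_between_def by blast
    then show ?thesis using that(2) by (simp add: topspace_Euclidean_space)
  qed
  have "continuous_map (subtopology (Euclidean_space m) V) euclideanreal (\<lambda>v. F v i)" for i
  proof (cases "i < n")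
    case True
    then have "C_diff 0 m V (\<lambda>v. F v i)"
      using assms(1) unfolding smooth_between_def smooth_fun_def by blast
    then show ?thesis by simp
  next
    case False
    have "continuous_map (subtopology (Euclidean_space m) V) euclideanreal (\<lambda>v. 0)" by simp
    then show ?thesis
      by (rule continuous_map_eq) (use False zero in auto)
  qed
  then show ?thesis
    using zero unfolding Euclidean_space_def[of n] continuous_map_in_subtopology
    by (auto simp: continuous_map_componentwise_UNIV)
qed

lemma smooth_between_openin_preimage:
  assumes "openin (Euclidean_space m) V" "openin (Euclidean_space n) U"
    "smooth_between m V n U F" "openin (Euclidean_space n) W"
  shows "openin (Euclidean_space m) {v \<in> V. F v \<in> W}"
  using smooth_between_continuous[OF assms(3,2)] assms(4)
  unfolding continuous_map_open_subtopology_iff[OF assms(1)] by blast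


section \<open>Constructions of diffeological spaces\<close>

lemma diffeological_spaceI:
  assumes "\<And>n U p. plot X n U p \<Longrightarrow> openin (Euclidean_space n) U"
    and "\<And>n U p u. plot X n U p \<Longrightarrow> u \<in> U \<Longrightarrow> p u \<in> pts X"
    and "\<And>n U p q. plot X n U p \<Longrightarrow> (\<And>u. u \<in> U \<Longrightarrow> p u = q u) \<Longrightarrow> plot X n U q"
    and "\<And>n U x. x \<in> pts X \<Longrightarrow> openin (Euclidean_space n) U \<Longrightarrow> plot X n U (\<lambda>_. x)"
    and "\<And>n U p. openin (Euclidean_space n) U \<Longrightarrow>
      (\<And>u. u \<in> U \<Longrightarrow> \<exists>V. u \<in> V \<and> V \<subseteq> U \<and> plot X n V p) \<Longrightarrow> plot X n U p"
    and "\<And>n U p m V F. plot X n U p \<Longrightarrow> openin (Euclidean_space m) V \<Longrightarrow>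
      smooth_between m V n U F \<Longrightarrow> plot X m V (p \<circ> F)"
  shows "diffeological_space X"
  unfolding diffeological_space_def
proof (intro conjI allI impI ballI Pi_I)
  fix n U p assume "plot X n U p"
  then show "openin (Euclidean_space n) U" by (rule assms(1))
next
  fix n U p u assume "plot X n U p" "u \<in> U"
  then show "p u \<in> pts X" by (rule assms(2))
next
  fix n U p q assume "plot X n U p" "\<forall>u\<in>U. p u = q u"
  then show "plot X n U q" using assms(3)[of n U p q] by blast
next
  fix n U x assume "x \<in> pts X" "openin (Euclidean_space n) U"
  then show "plot X n U (\<lambda>_. x)" by (rule assms(4))
next
  fix n U p
  assume "openin (Euclidean_space n) U" "\<forall>u\<in>U. \<exists>V. u \<in> V \<and> V \<subseteq> U \<and> plot X n V p"
  then show "plot X n U p" using assms(5)[of n U p] by blast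
next
  fix n U p m V F
  assume "plot X n U p" "openin (Euclidean_space m) V" "smooth_between m V n U F"
  then show "plot X m V (p \<circ> F)" by (rule assms(6))
qed

lemma
  assumes "diffeological_space X"
  shows plot_openin: "plot X n U p \<Longrightarrow> openin (Euclidean_space n) U"
    and plot_in_pts: "plot X n U p \<Longrightarrow> u \<in> U \<Longrightarrow> p u \<in> pts X"
    and plot_cong: "plot X n U p \<Longrightarrow> (\<And>u. u \<in> U \<Longrightarrow> p u = q u) \<Longrightarrow> plot X n U q"
    and plot_const: "x \<in> pts X \<Longrightarrow> openin (Euclidean_space n) U \<Longrightarrow> plot X n U (\<lambda>_. x)"
    and plot_local: "openin (Euclidean_space n) U \<Longrightarrow>
      (\<And>u. u \<in> U \<Longrightarrow> \<exists>V. u \<in> V \<and> V \<subseteq> U \<and> plot X n V p) \<Longrightarrow> plot X n U p"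
    and plot_compose: "plot X n U p \<Longrightarrow> openin (Euclidean_space m) V \<Longrightarrow>
      smooth_between m V n U F \<Longrightarrow> plot X m V (p \<circ> F)"
proof -
  note ax = assms[unfolded diffeological_space_def]
  show "plot X n U p \<Longrightarrow> openin (Euclidean_space n) U"
    and "plot X n U p \<Longrightarrow> u \<in> U \<Longrightarrow> p u \<in> pts X"
    using ax[THEN conjunct1] by blast+
  show "plot X n U p \<Longrightarrow> (\<And>u. u \<in> U \<Longrightarrow> p u = q u) \<Longrightarrow> plot X n U q"
    using ax[THEN conjunct2, THEN conjunct1, rule_format, of n U p q] by simp
  show "x \<in> pts X \<Longrightarrow> openin (Euclidean_space n) U \<Longrightarrow> plot X n U (\<lambda>_. x)"
    using ax[THEN conjunct2, THEN conjunct2, THEN conjunct1, rule_format] by simp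
  show "openin (Euclidean_space n) U \<Longrightarrow>
      (\<And>u. u \<in> U \<Longrightarrow> \<exists>V. u \<in> V \<and> V \<subseteq> U \<and> plot X n V p) \<Longrightarrow> plot X n U p"
    using ax[THEN conjunct2, THEN conjunct2, THEN conjunct2, THEN conjunct1, rule_format, of n U p]
    by simp
  show "plot X n U p \<Longrightarrow> openin (Euclidean_space m) V \<Longrightarrow>
      smooth_between m V n U F \<Longrightarrow> plot X m V (p \<circ> F)"
    using ax[THEN conjunct2, THEN conjunct2, THEN conjunct2, THEN conjunct2, rule_format] by blast
qed

lemma plot_restrict:
  assumes "diffeological_space X" "plot X n U p" "openin (Euclidean_space n) V" "V \<subseteq> U"
  shows "plot X n V p"
  using plot_compose[OF assms(1-3) smooth_between_inclusion[OF assms(4)]] by (simp add: o_def)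

lemma smooth_map_plot: "smooth_map X Y f \<Longrightarrow> plot X n U p \<Longrightarrow> plot Y n U (\<lambda>u. f (p u))"
  by (simp add: smooth_map_def o_def)

text \<open>
  Continuous maps from open sets of R^n into a topological space form a diffeology. For the discrete
  topology this is the discrete diffeology. For the real line it turns the universal property of a
  final diffeology into a criterion for continuity of a function along all plots.
\<close>

definition continuous_dspace :: "'a topology \<Rightarrow> 'a dspace" where
  "continuous_dspace T =
     \<lparr>pts = topspace T,
      plot = (\<lambda>n U p. openin (Euclidean_space n) U \<and>
                continuous_map (subtopology (Euclidean_space n) U) T p)\<rparr>"

lemma pts_continuous_dspace [simp]: "pts (continuous_dspace T) = topspace T"
  by (simp add: continuous_dspace_def)

lemma plot_continuous_dspace_iff:
  "plot (continuous_dspace T) n U p \<longleftrightarrow> openin (Euclidean_space n) U \<and>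
     p \<in> U \<rightarrow> topspace T \<and> (\<forall>S. openin T S \<longrightarrow> openin (Euclidean_space n) {u \<in> U. p u \<in> S})"
  by (auto simp: continuous_dspace_def continuous_map_open_subtopology_iff)

lemma diffeological_continuous_dspace: "diffeological_space (continuous_dspace T)"
proof (rule diffeological_spaceI)
  fix n U p q
  assume "plot (continuous_dspace T) n U p" "\<And>u. u \<in> U \<Longrightarrow> p u = q u"
  moreover from this(2) have "{u \<in> U. p u \<in> S} = {u \<in> U. q u \<in> S}" for S by auto
  ultimately show "plot (continuous_dspace T) n U q"
    by (auto simp: plot_continuous_dspace_iff)
next
  fix n U p
  assume U: "openin (Euclidean_space n) U"
    and loc: "\<And>u. u \<in> U \<Longrightarrow> \<exists>V. u \<in> V \<and> V \<subseteq> U \<and> plot (continuous_dspace T) n V p"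
  have "openin (Euclidean_space n) {u \<in> U. p u \<in> S}" if "openin T S" for S
  proof (subst openin_subopen, intro ballI)
    fix u assume "u \<in> {u \<in> U. p u \<in> S}"
    with loc obtain V where "u \<in> V" "V \<subseteq> U" "plot (continuous_dspace T) n V p" "p u \<in> S"
      by blast
    then show "\<exists>W. openin (Euclidean_space n) W \<and> u \<in> W \<and> W \<subseteq> {u \<in> U. p u \<in> S}"
      using that by (intro exI[of _ "{v \<in> V. p v \<in> S}"]) (auto simp: plot_continuous_dspace_iff)
  qed
  moreover have "p u \<in> topspace T" if "u \<in> U" for u
    using loc[OF that] by (auto simp: plot_continuous_dspace_iff)
  ultimately show "plot (continuous_dspace T) n U p"
    using U by (auto simp: plot_continuous_dspace_iff)
next
  fix n U p m V F
  assume p: "plot (continuous_dspace T) n U p" and V: "openin (Euclidean_space m) V"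
    and F: "smooth_between m V n U F"
  have "openin (Euclidean_space m) {v \<in> V. F v \<in> {u \<in> U. p u \<in> S}}" if "openin T S" for S
    using p that V F by (intro smooth_between_openin_preimage) (auto simp: plot_continuous_dspace_iff)
  moreover have "{v \<in> V. F v \<in> {u \<in> U. p u \<in> S}} = {v \<in> V. (p \<circ> F) v \<in> S}" for S
    using F by (auto simp: smooth_between_def)
  moreover have "p \<circ> F \<in> V \<rightarrow> topspace T"
    using p F by (auto simp: plot_continuous_dspace_iff smooth_between_def)
  ultimately show "plot (continuous_dspace T) m V (p \<circ> F)"
    using V by (simp add: plot_continuous_dspace_iff)
next
  fix n U x
  assume "x \<in> pts (continuous_dspace T)" "openin (Euclidean_space n) U"
  then show "plot (continuous_dspace T) n U (\<lambda>_. x)"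
    by (simp add: continuous_dspace_def)
qed (auto simp: plot_continuous_dspace_iff)

lemma discrete_dspace_eq: "discrete_dspace A = continuous_dspace (discrete_topology A)"
  by (simp add: discrete_dspace_def continuous_dspace_def)

lemma diffeological_discrete_dspace: "diffeological_space (discrete_dspace A)"
  by (simp add: discrete_dspace_eq diffeological_continuous_dspace)

lemma pts_discrete_dspace [simp]: "pts (discrete_dspace A) = A"
  by (simp add: discrete_dspace_def)

lemma plot_discrete_dspace_iff:
  "plot (discrete_dspace A) n U p \<longleftrightarrow> openin (Euclidean_space n) U \<and>
     p \<in> U \<rightarrow> A \<and> (\<forall>a\<in>A. openin (Euclidean_space n) {u \<in> U. p u = a})"
  by (auto simp: discrete_dspace_def continuous_map_open_discrete_iff)

lemma pts_prod_dspace [simp]: "pts (prod_dspace X Y) = pts X \<times> pts Y"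
  by (simp add: prod_dspace_def)

lemma plot_prod_dspace_iff:
  "plot (prod_dspace X Y) n U p \<longleftrightarrow>
     plot X n U (\<lambda>u. fst (p u)) \<and> plot Y n U (\<lambda>u. snd (p u))"
  by (simp add: prod_dspace_def o_def)

text \<open>
  Plots of a discrete space are locally constant, and being a plot is a local property. Hence a
  discrete variable may be frozen when smoothness is tested.
\<close>

lemma smooth_map_discrete:
  assumes Y: "diffeological_space Y" and f: "f \<in> A \<rightarrow> pts Y"
  shows "smooth_map (discrete_dspace A) Y f"
  unfolding smooth_map_def
proof (intro conjI allI impI)
  fix n U p
  assume p: "plot (discrete_dspace A) n U p"
  then have U: "openin (Euclidean_space n) U"
    by (simp add: plot_discrete_dspace_iff)
  show "plot Y n U (f \<circ> p)"
  proof (rule plot_local[OF Y U])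
    fix u assume u: "u \<in> U"
    define V where "V = {v \<in> U. p v = p u}"
    have "p u \<in> A" "openin (Euclidean_space n) V"
      using p u by (auto simp: plot_discrete_dspace_iff V_def)
    then have "plot Y n V (\<lambda>_. f (p u))"
      using f by (intro plot_const[OF Y]) auto
    then have "plot Y n V (f \<circ> p)"
      by (rule plot_cong[OF Y]) (simp add: V_def)
    then show "\<exists>V. u \<in> V \<and> V \<subseteq> U \<and> plot Y n V (f \<circ> p)"
      using u by (intro exI[of _ V]) (auto simp: V_def)
  qed
qed (use f in simp)

lemma smooth_map_discrete_prod:
  assumes X: "diffeological_space X" and Y: "diffeological_space Y"
    and f: "\<And>a. a \<in> A \<Longrightarrow> smooth_map X Y (f a)"
  shows "smooth_map (prod_dspace (discrete_dspace A) X) Y (\<lambda>(a, x). f a x)"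
  unfolding smooth_map_def
proof (intro conjI allI impI)
  show "(\<lambda>(a, x). f a x) \<in> pts (prod_dspace (discrete_dspace A) X) \<rightarrow> pts Y"
    using f by (auto simp: smooth_map_def)
  fix n U p
  assume p: "plot (prod_dspace (discrete_dspace A) X) n U p"
  then have fst: "plot (discrete_dspace A) n U (\<lambda>u. fst (p u))" and snd: "plot X n U (\<lambda>u. snd (p u))"
    by (auto simp: plot_prod_dspace_iff)
  show "plot Y n U ((\<lambda>(a, x). f a x) \<circ> p)"
  proof (rule plot_local[OF Y plot_openin[OF X snd]])
    fix u assume u: "u \<in> U"
    define V where "V = {v \<in> U. fst (p v) = fst (p u)}"
    have a: "fst (p u) \<in> A" and V: "openin (Euclidean_space n) V"
      using fst u by (auto simp: plot_discrete_dspace_iff V_def)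
    have "plot X n V (\<lambda>u. snd (p u))"
      using plot_restrict[OF X snd V] by (auto simp: V_def)
    then have "plot Y n V (\<lambda>v. f (fst (p u)) (snd (p v)))"
      using f[OF a] by (rule smooth_map_plot[rotated])
    then have "plot Y n V ((\<lambda>(a, x). f a x) \<circ> p)"
      by (rule plot_cong[OF Y]) (auto simp: V_def case_prod_beta)
    then show "\<exists>V. u \<in> V \<and> V \<subseteq> U \<and> plot Y n V ((\<lambda>(a, x). f a x) \<circ> p)"
      using u by (intro exI[of _ V]) (auto simp: V_def)
  qed
qed


section \<open>Final and quotient diffeologies\<close>

definition pullback_dspace :: "'a set \<Rightarrow> 'b dspace \<Rightarrow> ('a \<Rightarrow> 'b) \<Rightarrow> 'a dspace" where
  "pullback_dspace Y Z f =
     \<lparr>pts = Y, plot = (\<lambda>n U p. p \<in> U \<rightarrow> Y \<and> plot Z n U (\<lambda>u. f (p u)))\<rparr>"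

lemma pts_pullback_dspace [simp]: "pts (pullback_dspace Y Z f) = Y"
  by (simp add: pullback_dspace_def)

lemma diffeological_pullback_dspace:
  assumes Z: "diffeological_space Z" and f: "f \<in> Y \<rightarrow> pts Z"
  shows "diffeological_space (pullback_dspace Y Z f)"
proof (rule diffeological_spaceI)
  fix n U p q
  assume p: "plot (pullback_dspace Y Z f) n U p" and eq: "\<And>u. u \<in> U \<Longrightarrow> p u = q u"
  have "plot Z n U (\<lambda>u. f (q u))"
    by (rule plot_cong[OF Z, of _ _ "\<lambda>u. f (p u)"]) (use p eq in \<open>auto simp: pullback_dspace_def\<close>)
  then show "plot (pullback_dspace Y Z f) n U q"
    using p eq by (auto simp: pullback_dspace_def Pi_iff)
next
  fix n U p
  assume U: "openin (Euclidean_space n) U"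
    and loc: "\<And>u. u \<in> U \<Longrightarrow> \<exists>V. u \<in> V \<and> V \<subseteq> U \<and> plot (pullback_dspace Y Z f) n V p"
  have "plot Z n U (\<lambda>u. f (p u))"
    by (rule plot_local[OF Z U]) (use loc in \<open>fastforce simp: pullback_dspace_def\<close>)
  moreover have "p u \<in> Y" if "u \<in> U" for u
    using loc[OF that] by (auto simp: pullback_dspace_def)
  ultimately show "plot (pullback_dspace Y Z f) n U p"
    by (auto simp: pullback_dspace_def)
next
  fix n U p m V F
  assume p: "plot (pullback_dspace Y Z f) n U p" and V: "openin (Euclidean_space m) V"
    and F: "smooth_between m V n U F"
  show "plot (pullback_dspace Y Z f) m V (p \<circ> F)"
    using p F plot_compose[OF Z _ V F, of "\<lambda>u. f (p u)"]
    by (auto simp: pullback_dspace_def smooth_between_def o_def)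
qed (use assms in \<open>auto simp: pullback_dspace_def intro: plot_openin plot_const\<close>)

lemma pts_final_dspace [simp]: "pts (final_dspace Y I X f) = Y"
  by (simp add: final_dspace_def)

lemma plot_final_dspace_iff:
  "plot (final_dspace Y I X f) n U p \<longleftrightarrow>
     (\<forall>Z. diffeological_space Z \<and> pts Z = Y \<and> (\<forall>i\<in>I. smooth_map (X i) Z (f i)) \<longrightarrow> plot Z n U p)"
  by (simp add: final_dspace_def)

text \<open>
  The final diffeology is an intersection of diffeologies. It satisfies the axioms because the
  intersection is over a nonempty family: the coarse diffeology, which is the pullback of the
  one-point space, makes all maps into Y smooth.
\<close>

lemma diffeological_final_dspace:
  assumes X: "\<And>i n U p. i \<in> I \<Longrightarrow> plot (X i) n U p \<Longrightarrow>
      openin (Euclidean_space n) U \<and> p \<in> U \<rightarrow> pts (X i)"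
    and f: "\<And>i. i \<in> I \<Longrightarrow> f i \<in> pts (X i) \<rightarrow> Y"
  shows "diffeological_space (final_dspace Y I X f)"
proof -
  define C where "C = pullback_dspace Y (discrete_dspace {()}) (\<lambda>_. ())"
  have C: "diffeological_space C"
    unfolding C_def
    by (rule diffeological_pullback_dspace) (auto simp: diffeological_discrete_dspace)
  have "pts C = Y" by (simp add: C_def)
  have "f i (p u) \<in> Y" if "i \<in> I" "plot (X i) n U p" "u \<in> U" for i n U p u
    using X f that by blast
  then have "\<forall>i\<in>I. smooth_map (X i) C (f i)"
    unfolding smooth_map_def C_def pullback_dspace_def
    using f X by (auto simp: plot_discrete_dspace_iff)
  then have coarse: "plot C n U p" if "plot (final_dspace Y I X f) n U p" for n U p
    using that C \<open>pts C = Y\<close> unfolding plot_final_dspace_iff by blast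
  show ?thesis
  proof (rule diffeological_spaceI)
    fix n U p assume p: "plot (final_dspace Y I X f) n U p"
    show "openin (Euclidean_space n) U"
      using coarse[OF p] plot_openin[OF C] by blast
    fix u assume "u \<in> U"
    then show "p u \<in> pts (final_dspace Y I X f)"
      using plot_in_pts[OF C coarse[OF p]] \<open>pts C = Y\<close> by simp
  next
    fix n U p q
    assume p: "plot (final_dspace Y I X f) n U p" and eq: "\<And>u. u \<in> U \<Longrightarrow> p u = q u"
    have "plot Z n U q"
      if "diffeological_space Z" "pts Z = Y" "\<forall>i\<in>I. smooth_map (X i) Z (f i)" for Z
      using p that eq unfolding plot_final_dspace_iff by (intro plot_cong[of Z n U p q]) simp_all
    then show "plot (final_dspace Y I X f) n U q"
      unfolding plot_final_dspace_iff by blast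
  next
    fix n U x
    assume "x \<in> pts (final_dspace Y I X f)" "openin (Euclidean_space n) U"
    then show "plot (final_dspace Y I X f) n U (\<lambda>_. x)"
      unfolding plot_final_dspace_iff using plot_const by (metis pts_final_dspace)
  next
    fix n U p
    assume U: "openin (Euclidean_space n) U"
      and loc: "\<And>u. u \<in> U \<Longrightarrow> \<exists>V. u \<in> V \<and> V \<subseteq> U \<and> plot (final_dspace Y I X f) n V p"
    have "plot Z n U p" if "diffeological_space Z" "pts Z = Y" "\<forall>i\<in>I. smooth_map (X i) Z (f i)" for Z
    proof (rule plot_local[OF that(1) U])
      fix u assume "u \<in> U"
      from loc[OF this] show "\<exists>V. u \<in> V \<and> V \<subseteq> U \<and> plot Z n V p"
        unfolding plot_final_dspace_iff using that by blast
    qed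
    then show "plot (final_dspace Y I X f) n U p"
      unfolding plot_final_dspace_iff by blast
  next
    fix n U p m V F
    assume "plot (final_dspace Y I X f) n U p" "openin (Euclidean_space m) V"
      "smooth_between m V n U F"
    then show "plot (final_dspace Y I X f) m V (p \<circ> F)"
      unfolding plot_final_dspace_iff using plot_compose by blast
  qed
qed

lemma smooth_map_into_final:
  assumes "i \<in> I" "f i \<in> pts (X i) \<rightarrow> Y"
  shows "smooth_map (X i) (final_dspace Y I X f) (f i)"
  using assms unfolding smooth_map_def final_dspace_def by auto

text \<open>
  The universal property: the pullback along g of the diffeology of Z is one of the diffeologies
  that are intersected.
\<close>

lemma smooth_map_from_final:
  assumes Z: "diffeological_space Z" and g: "g \<in> Y \<rightarrow> pts Z"
    and X: "\<And>i n U p. i \<in> I \<Longrightarrow> plot (X i) n U p \<Longrightarrow> p \<in> U \<rightarrow> pts (X i)"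
    and f: "\<And>i. i \<in> I \<Longrightarrow> f i \<in> pts (X i) \<rightarrow> Y"
    and gf: "\<And>i. i \<in> I \<Longrightarrow> smooth_map (X i) Z (\<lambda>x. g (f i x))"
  shows "smooth_map (final_dspace Y I X f) Z g"
  unfolding smooth_map_def
proof (intro conjI allI impI)
  show "g \<in> pts (final_dspace Y I X f) \<rightarrow> pts Z" using g by simp
  fix n U p
  assume p: "plot (final_dspace Y I X f) n U p"
  have "smooth_map (X i) (pullback_dspace Y Z g) (f i)" if "i \<in> I" for i
    using f[OF that] gf[OF that] X[OF that] unfolding smooth_map_def pullback_dspace_def
    by (fastforce simp: o_def)
  then have "plot (pullback_dspace Y Z g) n U p"
    using p diffeological_pullback_dspace[OF Z g]
    unfolding plot_final_dspace_iff by simp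
  then show "plot Z n U (g \<circ> p)"
    by (simp add: pullback_dspace_def o_def)
qed

text \<open>
  The maps that lift locally to plots of E form a diffeology for which f is smooth, so they include the
  plots of the final one. Surjectivity is what makes constant maps lift.
\<close>

lemma plot_final_surj_lift:
  assumes E: "diffeological_space E" and f: "f ` pts E = Y"
    and p: "plot (final_dspace Y {()} (\<lambda>_. E) (\<lambda>_. f)) n U p" and u: "u \<in> U"
  obtains V q where "u \<in> V" "V \<subseteq> U" "plot E n V q" "\<And>v. v \<in> V \<Longrightarrow> p v = f (q v)"
proof -
  define lifts where "lifts n U p \<longleftrightarrow> openin (Euclidean_space n) U \<and>
      (\<forall>u\<in>U. \<exists>V q. u \<in> V \<and> V \<subseteq> U \<and> plot E n V q \<and> (\<forall>v\<in>V. p v = f (q v)))"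
    for n U and p :: "(nat \<Rightarrow> real) \<Rightarrow> 'b"
  define Z where "Z = \<lparr>pts = Y, plot = lifts\<rparr>"
  have [simp]: "pts Z = Y" "plot Z = lifts" by (simp_all add: Z_def)
  have "diffeological_space Z"
  proof (rule diffeological_spaceI)
    fix n U p assume p: "plot Z n U p"
    show "openin (Euclidean_space n) U" using p by (simp add: lifts_def)
    fix u assume "u \<in> U"
    then obtain V q where "u \<in> V" "plot E n V q" "p u = f (q u)"
      using p by (auto simp: lifts_def)
    then show "p u \<in> pts Z" using plot_in_pts[OF E] f by auto
  next
    fix n U p q
    assume p: "plot Z n U p" and eq: "\<And>u. u \<in> U \<Longrightarrow> p u = q u"
    show "plot Z n U q"
      unfolding \<open>plot Z = lifts\<close> lifts_def
    proof (intro conjI ballI)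
      show "openin (Euclidean_space n) U" using p by (simp add: lifts_def)
      fix u assume "u \<in> U"
      then obtain V r where "u \<in> V" "V \<subseteq> U" "plot E n V r" "\<forall>v\<in>V. p v = f (r v)"
        using p by (auto simp: lifts_def)
      then show "\<exists>V r. u \<in> V \<and> V \<subseteq> U \<and> plot E n V r \<and> (\<forall>v\<in>V. q v = f (r v))"
        using eq by (metis subsetD)
    qed
  next
    fix n U y assume "y \<in> pts Z" and U: "openin (Euclidean_space n) U"
    then obtain x where x: "x \<in> pts E" "y = f x" using f by auto
    show "plot Z n U (\<lambda>_. y)"
      using plot_const[OF E x(1) U] x(2) U unfolding \<open>plot Z = lifts\<close> lifts_def by blast
  next
    fix n U p
    assume U: "openin (Euclidean_space n) U"
      and loc: "\<And>u. u \<in> U \<Longrightarrow> \<exists>V. u \<in> V \<and> V \<subseteq> U \<and> plot Z n V p"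
    show "plot Z n U p"
      unfolding \<open>plot Z = lifts\<close> lifts_def
    proof (intro conjI ballI)
      fix u assume "u \<in> U"
      then obtain V where "u \<in> V" "V \<subseteq> U" "lifts n V p" using loc by auto
      then show "\<exists>V q. u \<in> V \<and> V \<subseteq> U \<and> plot E n V q \<and> (\<forall>v\<in>V. p v = f (q v))"
        unfolding lifts_def by (meson order_trans)
    qed (rule U)
  next
    fix n U p m V F
    assume p: "plot Z n U p" and V: "openin (Euclidean_space m) V"
      and F: "smooth_between m V n U F"
    show "plot Z m V (p \<circ> F)"
      unfolding \<open>plot Z = lifts\<close> lifts_def
    proof (intro conjI ballI)
      fix v assume v: "v \<in> V"
      then have "F v \<in> U" using F by (auto simp: smooth_between_def)
      then obtain W q where W: "F v \<in> W" "W \<subseteq> U" "plot E n W q" "\<forall>w\<in>W. p w = f (q w)"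
        using p by (auto simp: lifts_def)
      define V' where "V' = {v \<in> V. F v \<in> W}"
      have "openin (Euclidean_space m) V'"
        unfolding V'_def
        by (rule smooth_between_openin_preimage[OF V _ F plot_openin[OF E W(3)]])
          (use p in \<open>simp add: lifts_def\<close>)
      moreover have "smooth_between m V' n W F"
        by (rule smooth_between_restrict[OF F]) (auto simp: V'_def)
      ultimately have "plot E m V' (q \<circ> F)"
        by (rule plot_compose[OF E W(3)])
      then show "\<exists>V' r. v \<in> V' \<and> V' \<subseteq> V \<and> plot E m V' r \<and> (\<forall>v\<in>V'. (p \<circ> F) v = f (r v))"
        using v W by (intro exI[of _ V'] exI[of _ "q \<circ> F"]) (auto simp: V'_def)
    qed (rule V)
  qed
  moreover have "smooth_map E Z f"
    unfolding smooth_map_def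
  proof (intro conjI allI impI)
    fix n U p assume "plot E n U p"
    then show "plot Z n U (f \<circ> p)"
      using plot_openin[OF E] by (auto simp: lifts_def intro!: exI[of _ U] exI[of _ p])
  qed (use f in auto)
  ultimately have "lifts n U p"
    using p unfolding plot_final_dspace_iff by fastforce
  then show thesis
    using u that unfolding lifts_def by blast
qed


section \<open>Principal bundles with discrete structure group\<close>

lemma (in group_action) orbit_translate:
  assumes "x \<in> E" "h \<in> carrier G"
  shows "orbit G \<phi> (\<phi> h x) = orbit G \<phi> x"
proof -
  interpret group G
    using group_hom group_hom.axioms(1) by auto
  have sub: "orbit G \<phi> (\<phi> h x) \<subseteq> orbit G \<phi> x" if "x \<in> E" "h \<in> carrier G" for x h
    using that composition_rule[OF that(1) _ that(2), symmetric] unfolding orbit_def by fastforce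
  have "\<phi> h x \<in> E"
    using element_image[OF assms(2,1) refl] .
  then have "orbit G \<phi> (\<phi> (inv h) (\<phi> h x)) \<subseteq> orbit G \<phi> (\<phi> h x)"
    using assms by (intro sub) auto
  then show ?thesis
    using sub[OF assms] orbit_sym_aux[OF assms(2,1) refl] by auto
qed

lemma diffeological_group_discrete:
  assumes "group H"
  shows "diffeological_group H (discrete_dspace (carrier H))"
proof -
  interpret group H by (rule assms)
  have "smooth_map (prod_dspace (discrete_dspace (carrier H)) (discrete_dspace (carrier H)))
      (discrete_dspace (carrier H)) (\<lambda>(g, h). g \<otimes>\<^bsub>H\<^esub> h)"
    by (intro smooth_map_discrete_prod smooth_map_discrete diffeological_discrete_dspace) auto
  then show ?thesis
    unfolding diffeological_group_def
    by (auto intro!: assms smooth_map_discrete diffeological_discrete_dspace)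
qed

text \<open>
  For a discrete structure group, the only condition on a free action beyond smoothness of each
  translation is that the group element relating two plots is locally constant: this is
  smoothness of the inverse of \<open>(p, h) \<mapsto> (p, h p)\<close>.
\<close>

lemma principal_bundle_discreteI:
  assumes H: "group H" and E: "diffeological_space E" and act: "group_action H (pts E) \<phi>"
    and smooth: "\<And>h. h \<in> carrier H \<Longrightarrow> smooth_map E E (\<phi> h)"
    and free: "\<And>x h. x \<in> pts E \<Longrightarrow> h \<in> carrier H \<Longrightarrow> \<phi> h x = x \<Longrightarrow> h = \<one>\<^bsub>H\<^esub>"
    and translation: "\<And>n U p q h. plot E n U p \<Longrightarrow> plot E n U q \<Longrightarrow>
      (\<And>u. u \<in> U \<Longrightarrow> h u \<in> carrier H \<and> q u = \<phi> (h u) (p u)) \<Longrightarrow>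
      plot (discrete_dspace (carrier H)) n U h"
  shows "principal_bundle H (discrete_dspace (carrier H)) E \<phi>"
proof -
  interpret H: group H by (rule H)
  interpret group_action H "pts E" \<phi> by (rule act)
  let ?D = "discrete_dspace (carrier H)"
  let ?F = "\<lambda>(p, h). (p, \<phi> h p)"
  have action: "smooth_map (prod_dspace ?D E) E (\<lambda>(h, p). \<phi> h p)"
    using E smooth by (intro smooth_map_discrete_prod) auto
  have one: "\<phi> \<one>\<^bsub>H\<^esub> x = x" if "x \<in> pts E" for x
    using that id_eq_one by (metis restrict_apply')
  have inj: "h = k" if "x \<in> pts E" "h \<in> carrier H" "k \<in> carrier H" "\<phi> h x = \<phi> k x" for x h k
  proof -
    have "\<phi> (inv\<^bsub>H\<^esub> k \<otimes>\<^bsub>H\<^esub> h) x = \<phi> (inv\<^bsub>H\<^esub> k) (\<phi> k x)"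
      using composition_rule[OF that(1) _ that(2)] that by simp
    also have "\<dots> = x" using orbit_sym_aux[OF that(3,1) refl] .
    finally have "inv\<^bsub>H\<^esub> k \<otimes>\<^bsub>H\<^esub> h = \<one>\<^bsub>H\<^esub>"
      using free that by simp
    then show ?thesis
      using that by (metis H.inv_equality H.inv_inv H.inv_closed)
  qed
  have pts: "pts (fibre_product H E \<phi>) = {(p, q) \<in> pts E \<times> pts E. orbit H \<phi> p = orbit H \<phi> q}"
    by (auto simp: fibre_product_def subset_dspace_def)
  have bij: "bij_betw ?F (pts (prod_dspace E ?D)) (pts (fibre_product H E \<phi>))"
    unfolding bij_betw_def
  proof (intro conjI equalityI subsetI)
    show "inj_on ?F (pts (prod_dspace E ?D))"
      using inj by (auto simp: inj_on_def)
  next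
    fix z assume "z \<in> ?F ` pts (prod_dspace E ?D)"
    then show "z \<in> pts (fibre_product H E \<phi>)"
      using orbit_translate element_image by (auto simp: pts)
  next
    fix z assume "z \<in> pts (fibre_product H E \<phi>)"
    then obtain p q where z: "z = (p, q)" "p \<in> pts E" "q \<in> pts E" "orbit H \<phi> p = orbit H \<phi> q"
      by (auto simp: pts)
    then have "q \<in> orbit H \<phi> p" using orbit_refl by simp
    then obtain h where "h \<in> carrier H" "q = \<phi> h p" by (auto simp: orbit_def)
    then show "z \<in> ?F ` pts (prod_dspace E ?D)"
      using z by (intro image_eqI[of _ _ "(p, h)"]) auto
  qed
  have forward: "smooth_map (prod_dspace E ?D) (fibre_product H E \<phi>) ?F"
    unfolding smooth_map_def
  proof (intro conjI allI impI)
    show "?F \<in> pts (prod_dspace E ?D) \<rightarrow> pts (fibre_product H E \<phi>)"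
      using bij by (rule bij_betw_imp_funcset)
    fix n U r assume r: "plot (prod_dspace E ?D) n U r"
    then have p: "plot E n U (\<lambda>u. fst (r u))" and h: "plot ?D n U (\<lambda>u. snd (r u))"
      by (simp_all add: plot_prod_dspace_iff)
    then have "plot (prod_dspace ?D E) n U (\<lambda>u. (snd (r u), fst (r u)))"
      by (simp add: plot_prod_dspace_iff)
    then have "plot E n U (\<lambda>u. \<phi> (snd (r u)) (fst (r u)))"
      using smooth_map_plot[OF action] by fastforce
    moreover have "orbit H \<phi> (fst (r u)) = orbit H \<phi> (\<phi> (snd (r u)) (fst (r u)))" if "u \<in> U" for u
      using orbit_translate plot_in_pts[OF E p that] plot_in_pts[OF diffeological_discrete_dspace h that]
      by simp
    ultimately show "plot (fibre_product H E \<phi>) n U (?F \<circ> r)"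
      using p by (simp add: fibre_product_def subset_dspace_def plot_prod_dspace_iff case_prod_beta)
  qed
  let ?G = "inv_into (pts (prod_dspace E ?D)) ?F"
  have backward: "smooth_map (fibre_product H E \<phi>) (prod_dspace E ?D) ?G"
    unfolding smooth_map_def
  proof (intro conjI allI impI)
    show "?G \<in> pts (fibre_product H E \<phi>) \<rightarrow> pts (prod_dspace E ?D)"
      using bij_betw_inv_into[OF bij] by (rule bij_betw_imp_funcset)
    fix n U r assume r: "plot (fibre_product H E \<phi>) n U r"
    then have pq: "plot E n U (\<lambda>u. fst (r u))" "plot E n U (\<lambda>u. snd (r u))"
      and orb: "\<And>u. u \<in> U \<Longrightarrow> orbit H \<phi> (fst (r u)) = orbit H \<phi> (snd (r u))"
      by (simp_all add: fibre_product_def subset_dspace_def plot_prod_dspace_iff Pi_iff case_prod_beta)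
    have G: "fst (?G (r u)) = fst (r u)" "snd (?G (r u)) \<in> carrier H"
      "snd (r u) = \<phi> (snd (?G (r u))) (fst (r u))" if "u \<in> U" for u
    proof -
      have ru: "r u \<in> pts (fibre_product H E \<phi>)"
        using plot_in_pts[OF E pq(1) that] plot_in_pts[OF E pq(2) that] orb[OF that]
        by (simp add: pts case_prod_beta mem_Times_iff)
      then have "?F (?G (r u)) = r u"
        using bij by (simp add: bij_betw_inv_into_right)
      then have eq: "(fst (?G (r u)), \<phi> (snd (?G (r u))) (fst (?G (r u)))) = r u"
        by (simp add: case_prod_beta)
      from arg_cong[OF eq, of fst] show fst: "fst (?G (r u)) = fst (r u)"
        unfolding fst_conv .
      from arg_cong[OF eq, of snd] show "snd (r u) = \<phi> (snd (?G (r u))) (fst (r u))"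
        unfolding snd_conv fst by (rule sym)
      show "snd (?G (r u)) \<in> carrier H"
        using bij_betwE[OF bij_betw_inv_into[OF bij]] ru by (auto simp: mem_Times_iff)
    qed
    have "plot ?D n U (\<lambda>u. snd (?G (r u)))"
      by (rule translation[OF pq]) (intro conjI G)
    moreover have "plot E n U (\<lambda>u. fst (?G (r u)))"
      by (rule plot_cong[OF E pq(1)]) (rule G(1)[symmetric])
    ultimately show "plot (prod_dspace E ?D) n U (?G \<circ> r)"
      by (simp add: plot_prod_dspace_iff)
  qed
  have "stabilizer H \<phi> x = {\<one>\<^bsub>H\<^esub>}" if "x \<in> pts E" for x
    using that free one by (auto simp: stabilizer_def)
  then show ?thesis
    unfolding principal_bundle_def smooth_free_action_def diffeomorphism_def
    using diffeological_group_discrete[OF H] E act action bij forward backward by blast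
qed


section \<open>Cech classes and change of index sets\<close>

lemma locally_constant_subset:
  "locally_constant T A U f \<Longrightarrow> V \<subseteq> U \<Longrightarrow> locally_constant T A V f"
  unfolding locally_constant_def by (rule continuous_map_from_subtopology_mono)

lemma (in monoid) locally_constant_mult:
  assumes "locally_constant T (carrier G) U f" "locally_constant T (carrier G) U g"
  shows "locally_constant T (carrier G) U (\<lambda>x. f x \<otimes> g x)"
proof -
  have "continuous_map (subtopology T U)
      (prod_topology (discrete_topology (carrier G)) (discrete_topology (carrier G))) (\<lambda>x. (f x, g x))"
    using assms unfolding locally_constant_def by (rule continuous_map_pairedI)
  then have "continuous_map (subtopology T U) (discrete_topology (carrier G \<times> carrier G)) (\<lambda>x. (f x, g x))"
    by (simp add: prod_topology_discrete_topology)
  moreover have "continuous_map (discrete_topology (carrier G \<times> carrier G))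
      (discrete_topology (carrier G)) (\<lambda>(a, b). a \<otimes> b)"
    by auto
  ultimately have "continuous_map (subtopology T U) (discrete_topology (carrier G))
      ((\<lambda>(a, b). a \<otimes> b) \<circ> (\<lambda>x. (f x, g x)))"
    by (rule continuous_map_compose)
  then show ?thesis by (simp add: locally_constant_def o_def)
qed

lemma locally_constant_in:
  assumes "locally_constant T A U f" "x \<in> U" "x \<in> topspace T"
  shows "f x \<in> A"
  using continuous_map_image_subset_topspace[OF assms(1)[unfolded locally_constant_def]] assms(2,3)
  by auto

text \<open>
  Choosing one index for each member of a refining cover replaces an index set of arbitrary type by a
  set of sets of points, which is what the definition of equivalence quantifies over.
\<close>

lemma cech_equivI:
  fixes K :: "'k set"
  assumes "cech_cocycle T H (I, U, g)" "cech_cocycle T H (J, V, h)"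
    and cover: "open_cover T K W" and r: "refinement K W I U r" and t: "refinement K W J V t"
    and coh: "cech_cohomologous T H K W (\<lambda>k l. g (r k) (r l)) (\<lambda>k l. h (t k) (t l))"
  shows "cech_equiv T H (I, U, g) (J, V, h)"
proof -
  define \<sigma> where "\<sigma> = inv_into K W"
  have \<sigma>: "\<sigma> A \<in> K" "W (\<sigma> A) = A" if "A \<in> W ` K" for A
    using that by (simp_all add: \<sigma>_def inv_into_into f_inv_into_f)
  have "open_cover T (W ` K) (\<lambda>A. A)"
    using cover by (auto simp: open_cover_def)
  moreover have "refinement (W ` K) (\<lambda>A. A) I U (r \<circ> \<sigma>)"
    unfolding refinement_def
  proof (intro conjI ballI Pi_I)
    fix A assume "A \<in> W ` K"
    from \<sigma>[OF this] show "(r \<circ> \<sigma>) A \<in> I" "A \<subseteq> U ((r \<circ> \<sigma>) A)"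
      using r unfolding refinement_def by auto
  qed
  moreover have "refinement (W ` K) (\<lambda>A. A) J V (t \<circ> \<sigma>)"
    unfolding refinement_def
  proof (intro conjI ballI Pi_I)
    fix A assume "A \<in> W ` K"
    from \<sigma>[OF this] show "(t \<circ> \<sigma>) A \<in> J" "A \<subseteq> V ((t \<circ> \<sigma>) A)"
      using t unfolding refinement_def by auto
  qed
  moreover have "cech_cohomologous T H (W ` K) (\<lambda>A. A)
      (\<lambda>A B. g ((r \<circ> \<sigma>) A) ((r \<circ> \<sigma>) B)) (\<lambda>A B. h ((t \<circ> \<sigma>) A) ((t \<circ> \<sigma>) B))"
  proof -
    obtain c where lc: "\<And>k. k \<in> K \<Longrightarrow> locally_constant T (carrier H) (W k) (c k)"
      and eq: "\<And>k l x. k \<in> K \<Longrightarrow> l \<in> K \<Longrightarrow> x \<in> W k \<inter> W l \<Longrightarrow>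
        h (t k) (t l) x = g (r k) (r l) x \<otimes>\<^bsub>H\<^esub> (c l x \<otimes>\<^bsub>H\<^esub> inv\<^bsub>H\<^esub> (c k x))"
      using coh unfolding cech_cohomologous_def by blast
    have "locally_constant T (carrier H) A ((c \<circ> \<sigma>) A)" if "A \<in> W ` K" for A
      using lc[OF \<sigma>(1)[OF that]] \<sigma>(2)[OF that] by simp
    moreover have "h ((t \<circ> \<sigma>) A) ((t \<circ> \<sigma>) B) x = g ((r \<circ> \<sigma>) A) ((r \<circ> \<sigma>) B) x \<otimes>\<^bsub>H\<^esub>
        ((c \<circ> \<sigma>) B x \<otimes>\<^bsub>H\<^esub> inv\<^bsub>H\<^esub> ((c \<circ> \<sigma>) A x))"
      if "A \<in> W ` K" "B \<in> W ` K" "x \<in> A \<inter> B" for A B x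
      using eq[OF \<sigma>(1)[OF that(1)] \<sigma>(1)[OF that(2)], of x] that(3) \<sigma>(2)[OF that(1)] \<sigma>(2)[OF that(2)]
      by simp
    ultimately show ?thesis
      unfolding cech_cohomologous_def by (intro exI[of _ "c \<circ> \<sigma>"]) blast
  qed
  ultimately show ?thesis
    using assms(1,2) unfolding cech_equiv_def prod.case by blast
qed

text \<open>
  Given a cover that refines U and V and a cover that refines V and W, take all intersections of
  their members. The two refinement maps into V need not agree on an intersection, so the
  comparison cochain is the product of the given ones and the value of h on the pair of chosen
  members of V.
\<close>

lemma cech_equiv_trans:
  fixes T :: "'x topology"
  assumes H: "comm_group H"
    and eq1: "cech_equiv T H (I, U, g) (J, V, h)" and eq2: "cech_equiv T H (J, V, h) (L, W, m)"
  shows "cech_equiv T H (I, U, g) (L, W, m)"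
proof -
  interpret comm_group H by (rule H)
  have coc: "cech_cocycle T H (I, U, g)" "cech_cocycle T H (J, V, h)" "cech_cocycle T H (L, W, m)"
    using eq1 eq2 by (simp_all add: cech_equiv_def)
  obtain K1 :: "'x set set" and W1 r1 t1 where K1: "open_cover T K1 W1" "refinement K1 W1 I U r1" "refinement K1 W1 J V t1"
    and "cech_cohomologous T H K1 W1 (\<lambda>k l. g (r1 k) (r1 l)) (\<lambda>k l. h (t1 k) (t1 l))"
    using eq1 unfolding cech_equiv_def prod.case by blast
  from this(4) obtain c1 where c1: "\<And>k. k \<in> K1 \<Longrightarrow> locally_constant T (carrier H) (W1 k) (c1 k)"
    and h1: "\<And>k l x. k \<in> K1 \<Longrightarrow> l \<in> K1 \<Longrightarrow> x \<in> W1 k \<inter> W1 l \<Longrightarrow>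
      h (t1 k) (t1 l) x = g (r1 k) (r1 l) x \<otimes>\<^bsub>H\<^esub> (c1 l x \<otimes>\<^bsub>H\<^esub> inv\<^bsub>H\<^esub> (c1 k x))"
    unfolding cech_cohomologous_def by blast
  obtain K2 :: "'x set set" and W2 r2 t2 where K2: "open_cover T K2 W2" "refinement K2 W2 J V r2" "refinement K2 W2 L W t2"
    and "cech_cohomologous T H K2 W2 (\<lambda>k l. h (r2 k) (r2 l)) (\<lambda>k l. m (t2 k) (t2 l))"
    using eq2 unfolding cech_equiv_def prod.case by blast
  from this(4) obtain c2 where c2: "\<And>k. k \<in> K2 \<Longrightarrow> locally_constant T (carrier H) (W2 k) (c2 k)"
    and m2: "\<And>k l x. k \<in> K2 \<Longrightarrow> l \<in> K2 \<Longrightarrow> x \<in> W2 k \<inter> W2 l \<Longrightarrow>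
      m (t2 k) (t2 l) x = h (r2 k) (r2 l) x \<otimes>\<^bsub>H\<^esub> (c2 l x \<otimes>\<^bsub>H\<^esub> inv\<^bsub>H\<^esub> (c2 k x))"
    unfolding cech_cohomologous_def by blast
  define X where "X = (\<lambda>(k, l). W1 k \<inter> W2 l)"
  define c where "c = (\<lambda>(k, l) x. c1 k x \<otimes>\<^bsub>H\<^esub> h (t1 k) (r2 l) x \<otimes>\<^bsub>H\<^esub> c2 l x)"
  have sub1: "W1 k \<subseteq> topspace T" "W1 k \<subseteq> U (r1 k)" "W1 k \<subseteq> V (t1 k)" "t1 k \<in> J" "r1 k \<in> I"
    if "k \<in> K1" for k
    using that K1 unfolding open_cover_def refinement_def by blast+
  have sub2: "W2 k \<subseteq> topspace T" "W2 k \<subseteq> V (r2 k)" "W2 k \<subseteq> W (t2 k)" "r2 k \<in> J" "t2 k \<in> L"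
    if "k \<in> K2" for k
    using that K2 unfolding open_cover_def refinement_def by blast+
  have lc_g: "locally_constant T (carrier H) (U a \<inter> U b) (g a b)" if "a \<in> I" "b \<in> I" for a b
    using coc(1) that unfolding cech_cocycle_def prod.case by blast
  have lc_h: "locally_constant T (carrier H) (V a \<inter> V b) (h a b)" if "a \<in> J" "b \<in> J" for a b
    using coc(2) that unfolding cech_cocycle_def prod.case by blast
  have cocycle_h: "h a b x \<otimes>\<^bsub>H\<^esub> h b d x = h a d x"
    if "a \<in> J" "b \<in> J" "d \<in> J" "x \<in> V a \<inter> V b \<inter> V d" for a b d x
    using coc(2) that unfolding cech_cocycle_def prod.case by blast
  show ?thesis
  proof (rule cech_equivI[OF coc(1,3), of "K1 \<times> K2" X "r1 \<circ> fst" "t2 \<circ> snd"])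
    have "(\<Union>k\<in>K1 \<times> K2. X k) = (\<Union>k\<in>K1. W1 k) \<inter> (\<Union>l\<in>K2. W2 l)"
      by (auto simp: X_def)
    then show "open_cover T (K1 \<times> K2) X"
      using K1(1) K2(1) by (auto simp: open_cover_def X_def)
    show "refinement (K1 \<times> K2) X I U (r1 \<circ> fst)"
      using sub1(2,5) by (auto simp: refinement_def X_def dest: subsetD)
    show "refinement (K1 \<times> K2) X L W (t2 \<circ> snd)"
      using subsetD[OF sub2(3)] sub2(5) by (auto simp: refinement_def X_def)
    have "locally_constant T (carrier H) (X kl) (c kl)" if kl: "kl \<in> K1 \<times> K2" for kl
    proof -
      obtain k l where [simp]: "kl = (k, l)" and k: "k \<in> K1" and l: "l \<in> K2" using kl by blast
      have "locally_constant T (carrier H) (X kl) (c1 k)" "locally_constant T (carrier H) (X kl) (c2 l)"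
        using locally_constant_subset[OF c1[OF k]] locally_constant_subset[OF c2[OF l]]
        by (auto simp: X_def)
      moreover have "locally_constant T (carrier H) (X kl) (h (t1 k) (r2 l))"
        using sub1[OF k] sub2[OF l] by (intro locally_constant_subset[OF lc_h]) (auto simp: X_def)
      ultimately show ?thesis
        by (simp add: c_def locally_constant_mult)
    qed
    moreover have "m (t2 l) (t2 l') x = g (r1 k) (r1 k') x \<otimes>\<^bsub>H\<^esub> (c (k', l') x \<otimes>\<^bsub>H\<^esub> inv\<^bsub>H\<^esub> (c (k, l) x))"
      if kl: "k \<in> K1" "l \<in> K2" "k' \<in> K1" "l' \<in> K2" and x: "x \<in> X (k, l) \<inter> X (k', l')" for k l k' l' x
    proof -
      have xW: "x \<in> W1 k" "x \<in> W1 k'" "x \<in> W2 l" "x \<in> W2 l'" "x \<in> topspace T"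
        using x sub1(1)[OF kl(1)] by (auto simp: X_def)
      have xUV: "x \<in> U (r1 k)" "x \<in> U (r1 k')" "x \<in> V (t1 k)" "x \<in> V (t1 k')" "x \<in> V (r2 l)" "x \<in> V (r2 l')"
        using xW sub1 sub2 kl by blast+
      note idx = sub1(4,5)[OF kl(1)] sub1(4,5)[OF kl(3)] sub2(4)[OF kl(2)] sub2(4)[OF kl(4)]
      have inH: "h a b x \<in> carrier H" if "a \<in> J" "b \<in> J" "x \<in> V a" "x \<in> V b" for a b
        by (rule locally_constant_in[OF lc_h]) (use that xW in auto)
      have "g (r1 k) (r1 k') x \<in> carrier H"
        by (rule locally_constant_in[OF lc_g]) (use idx xUV xW in auto)
      moreover have "c1 k x \<in> carrier H" "c1 k' x \<in> carrier H" "c2 l x \<in> carrier H" "c2 l' x \<in> carrier H"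
        using locally_constant_in[OF c1 _ xW(5)] locally_constant_in[OF c2 _ xW(5)] kl xW(1-4) by simp_all
      moreover have "h (t1 k) (r2 l) x \<in> carrier H" "h (t1 k') (r2 l') x \<in> carrier H"
        "h (r2 l) (r2 l') x \<in> carrier H"
        using inH idx xUV by auto
      ultimately have mem: "g (r1 k) (r1 k') x \<in> carrier H" "h (t1 k) (r2 l) x \<in> carrier H"
        "h (t1 k') (r2 l') x \<in> carrier H" "h (r2 l) (r2 l') x \<in> carrier H"
        "c1 k x \<in> carrier H" "c1 k' x \<in> carrier H" "c2 l x \<in> carrier H" "c2 l' x \<in> carrier H"
        by blast+
      have "h (t1 k) (r2 l) x \<otimes>\<^bsub>H\<^esub> h (r2 l) (r2 l') x = h (t1 k) (t1 k') x \<otimes>\<^bsub>H\<^esub> h (t1 k') (r2 l') x"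
        using cocycle_h idx xUV by simp
      also have "h (t1 k) (t1 k') x = g (r1 k) (r1 k') x \<otimes>\<^bsub>H\<^esub> (c1 k' x \<otimes>\<^bsub>H\<^esub> inv\<^bsub>H\<^esub> c1 k x)"
        using h1 kl xW by simp
      finally have "h (r2 l) (r2 l') x = inv\<^bsub>H\<^esub> h (t1 k) (r2 l) x \<otimes>\<^bsub>H\<^esub>
          (g (r1 k) (r1 k') x \<otimes>\<^bsub>H\<^esub> (c1 k' x \<otimes>\<^bsub>H\<^esub> inv\<^bsub>H\<^esub> c1 k x) \<otimes>\<^bsub>H\<^esub> h (t1 k') (r2 l') x)"
        using mem by (metis inv_solve_left m_closed inv_closed)
      then show ?thesis
        using m2[OF kl(2,4), of x] xW mem by (simp add: c_def inv_mult m_ac)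
    qed
    ultimately show "cech_cohomologous T H (K1 \<times> K2) X
        (\<lambda>k l. g ((r1 \<circ> fst) k) ((r1 \<circ> fst) l)) (\<lambda>k l. m ((t2 \<circ> snd) k) ((t2 \<circ> snd) l))"
      unfolding cech_cohomologous_def by (intro exI[of _ c]) auto
  qed
qed


section \<open>The characteristic class of a bundle with discrete abelian structure group\<close>

locale discrete_principal_bundle = comm_group H for H :: "('h, 'm) monoid_scheme" (structure) +
  fixes E :: "'e dspace" and \<phi> :: "'h \<Rightarrow> 'e \<Rightarrow> 'e"
  assumes principal: "principal_bundle H (discrete_dspace (carrier H)) E \<phi>"
begin

abbreviation "B \<equiv> quotient_dspace H E \<phi>"

abbreviation "T \<equiv> D_topology B"

lemma diffeological_total: "diffeological_space E"
  using principal by (simp add: principal_bundle_def)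

sublocale group_action H "pts E" \<phi>
  using principal by (simp add: principal_bundle_def smooth_free_action_def)

lemma diffeological_base: "diffeological_space B"
  unfolding quotient_dspace_def
  by (rule diffeological_final_dspace)
    (use plot_openin plot_in_pts diffeological_total in \<open>fastforce simp: orbits_def\<close>)+

lemma translation_bij:
  "bij_betw (\<lambda>(p, h). (p, \<phi> h p)) (pts E \<times> carrier H) (pts (fibre_product H E \<phi>))"
  using principal by (simp add: principal_bundle_def diffeomorphism_def)

lemma action_free:
  assumes "x \<in> pts E" "h \<in> carrier H" "k \<in> carrier H" "\<phi> h x = \<phi> k x"
  shows "h = k"
  using inj_onD[OF bij_betw_imp_inj_on[OF translation_bij], of "(x, h)" "(x, k)"] assms by auto

text \<open>
  The inverse of the diffeomorphism \<open>(p, h) \<mapsto> (p, h p)\<close> sends a pair of points of one fibre to the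
  group element that relates them. Its smoothness makes this element locally constant along plots.
\<close>

lemma plot_translation:
  assumes p: "plot E n U p" and q: "plot E n U q"
    and h: "\<And>u. u \<in> U \<Longrightarrow> h u \<in> carrier H" "\<And>u. u \<in> U \<Longrightarrow> q u = \<phi> (h u) (p u)"
  shows "plot (discrete_dspace (carrier H)) n U h"
proof -
  let ?F = "\<lambda>(p, h). (p, \<phi> h p)"
  let ?G = "inv_into (pts (prod_dspace E (discrete_dspace (carrier H)))) ?F"
  have pE: "p u \<in> pts E" if "u \<in> U" for u
    using plot_in_pts[OF diffeological_total p that] .
  have "orbit H \<phi> (p u) = orbit H \<phi> (q u)" if "u \<in> U" for u
    using that h orbit_translate pE by simp
  then have "plot (fibre_product H E \<phi>) n U (\<lambda>u. (p u, q u))"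
    using p q by (simp add: fibre_product_def subset_dspace_def plot_prod_dspace_iff)
  moreover have "smooth_map (fibre_product H E \<phi>) (prod_dspace E (discrete_dspace (carrier H))) ?G"
    using principal by (simp add: principal_bundle_def diffeomorphism_def)
  ultimately have "plot (prod_dspace E (discrete_dspace (carrier H))) n U (\<lambda>u. ?G (p u, q u))"
    by (rule smooth_map_plot[rotated])
  then have "plot (discrete_dspace (carrier H)) n U (\<lambda>u. snd (?G (p u, q u)))"
    unfolding plot_prod_dspace_iff by (rule conjunct2)
  moreover have "?G (p u, q u) = (p u, h u)" if "u \<in> U" for u
    using bij_betw_imp_inj_on[OF translation_bij] pE[OF that] h[OF that]
    by (intro inv_into_f_eq) auto
  ultimately show ?thesis
    by (elim plot_cong[OF diffeological_discrete_dspace]) simp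
qed

definition smooth_section :: "'e set set \<Rightarrow> ('e set \<Rightarrow> 'e) \<Rightarrow> bool" where
  "smooth_section U s \<longleftrightarrow> openin T U \<and> smooth_map (subset_dspace B U) E s \<and>
     (\<forall>x\<in>U. orbit H \<phi> (s x) = x)"

lemma smooth_section_in:
  assumes "smooth_section U s" "x \<in> U"
  shows "s x \<in> pts E"
proof -
  have "U \<subseteq> pts B"
    using assms(1) by (auto simp: smooth_section_def openin_D_topology)
  then show ?thesis
    using assms by (auto simp: smooth_section_def smooth_map_def subset_dspace_def)
qed

lemma smooth_sections_related:
  assumes "smooth_section U s" "smooth_section V t" "x \<in> U \<inter> V"
  shows "\<exists>h\<in>carrier H. t x = \<phi> h (s x)"
proof -
  have "t x \<in> orbit H \<phi> (t x)"
    using assms smooth_section_in orbit_refl by blast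
  also have "orbit H \<phi> (t x) = orbit H \<phi> (s x)"
    using assms by (simp add: smooth_section_def)
  finally show ?thesis by (auto simp: orbit_def)
qed

text \<open>
  Composing two sections with a plot of the base gives two plots in the same fibres, so their
  transition function is locally constant along every plot. This is continuity for the D-topology.
\<close>

lemma locally_constant_transition:
  assumes s: "smooth_section U s" and t: "smooth_section V t"
    and h: "\<And>x. x \<in> U \<inter> V \<Longrightarrow> h x \<in> carrier H" "\<And>x. x \<in> U \<inter> V \<Longrightarrow> t x = \<phi> (h x) (s x)"
  shows "locally_constant T (carrier H) (U \<inter> V) h"
proof -
  have UV: "openin T (U \<inter> V)" and smooth: "smooth_map (subset_dspace B U) E s" "smooth_map (subset_dspace B V) E t"
    using s t by (auto simp: smooth_section_def)
  have "openin T {x \<in> U \<inter> V. h x = a}" if a: "a \<in> carrier H" for a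
    unfolding openin_D_topology
  proof (intro conjI allI impI)
    show "{x \<in> U \<inter> V. h x = a} \<subseteq> pts B"
      using UV by (auto simp: openin_D_topology)
    fix n P p assume p: "plot B n P p"
    define P' where "P' = {u \<in> P. p u \<in> U \<inter> V}"
    have "openin (Euclidean_space n) P'"
      using UV p unfolding openin_D_topology P'_def by blast
    then have p': "plot B n P' p"
      using plot_restrict[OF diffeological_base p] by (auto simp: P'_def)
    then have "plot (subset_dspace B U) n P' p" "plot (subset_dspace B V) n P' p"
      by (auto simp: subset_dspace_def P'_def)
    then have "plot E n P' (\<lambda>u. s (p u))" "plot E n P' (\<lambda>u. t (p u))"
      by (simp_all only: smooth_map_plot[OF smooth(1)] smooth_map_plot[OF smooth(2)])
    then have "plot (discrete_dspace (carrier H)) n P' (\<lambda>u. h (p u))"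
      by (rule plot_translation) (use h in \<open>auto simp: P'_def\<close>)
    then have "openin (Euclidean_space n) {u \<in> P'. h (p u) = a}"
      using a by (simp add: plot_discrete_dspace_iff)
    moreover have "{u \<in> P'. h (p u) = a} = {u \<in> P. p u \<in> {x \<in> U \<inter> V. h x = a}}"
      by (auto simp: P'_def)
    ultimately show "openin (Euclidean_space n) {u \<in> P. p u \<in> {x \<in> U \<inter> V. h x = a}}"
      by simp
  qed
  then show ?thesis
    unfolding locally_constant_def continuous_map_open_discrete_iff[OF UV] using h(1) by blast
qed

lemma local_sections_iff:
  "local_sections H E \<phi> I U s \<longleftrightarrow> open_cover T I U \<and> (\<forall>a\<in>I. smooth_section (U a) (s a))"
  by (auto simp: local_sections_def smooth_section_def open_cover_def)

lemma ex_transition_functions: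
  assumes "local_sections H E \<phi> I U s"
  shows "\<exists>g. transition_functions H \<phi> I U s g"
proof -
  have "\<forall>a b x. \<exists>h. a \<in> I \<longrightarrow> b \<in> I \<longrightarrow> x \<in> U a \<inter> U b \<longrightarrow> h \<in> carrier H \<and> s b x = \<phi> h (s a x)"
    using assms smooth_sections_related unfolding local_sections_iff by metis
  then obtain g where "\<forall>a b x. a \<in> I \<longrightarrow> b \<in> I \<longrightarrow> x \<in> U a \<inter> U b \<longrightarrow>
      g a b x \<in> carrier H \<and> s b x = \<phi> (g a b x) (s a x)"
    by metis
  then show ?thesis
    unfolding transition_functions_def by blast
qed

lemma cech_cocycle_transition:
  assumes s: "local_sections H E \<phi> I U s" and g: "transition_functions H \<phi> I U s g"
  shows "cech_cocycle T H (I, U, g)"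
proof -
  have sec: "\<And>a. a \<in> I \<Longrightarrow> smooth_section (U a) (s a)"
    using s by (simp add: local_sections_iff)
  have g: "g a b x \<in> carrier H" "s b x = \<phi> (g a b x) (s a x)"
    if "a \<in> I" "b \<in> I" "x \<in> U a \<inter> U b" for a b x
    using g that unfolding transition_functions_def by blast+
  have "g a b x \<otimes> g b c x = g a c x"
    if "a \<in> I" "b \<in> I" "c \<in> I" "x \<in> U a \<inter> U b \<inter> U c" for a b c x
  proof (rule action_free)
    show "s a x \<in> pts E" using sec smooth_section_in that by blast
    have gab: "g a b x \<in> carrier H" "g b c x \<in> carrier H" and gac: "g a c x \<in> carrier H"
      using g that by blast+
    then show "g a b x \<otimes> g b c x \<in> carrier H" "g a c x \<in> carrier H" by simp_all
    have sb: "s b x = \<phi> (g a b x) (s a x)" and sc: "s c x = \<phi> (g b c x) (s b x)"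
      and sac: "s c x = \<phi> (g a c x) (s a x)"
      by (rule g(2); use that in blast)+
    have "\<phi> (g a b x \<otimes> g b c x) (s a x) = \<phi> (g b c x) (\<phi> (g a b x) (s a x))"
      unfolding m_comm[OF gab] by (rule composition_rule[OF \<open>s a x \<in> pts E\<close> gab(2,1)])
    also have "\<dots> = \<phi> (g a c x) (s a x)"
      unfolding sb[symmetric] sc[symmetric] by (rule sac)
    finally show "\<phi> (g a b x \<otimes> g b c x) (s a x) = \<phi> (g a c x) (s a x)" .
  qed
  moreover have "locally_constant T (carrier H) (U a \<inter> U b) (g a b)" if "a \<in> I" "b \<in> I" for a b
    using locally_constant_transition[OF sec sec] g that by blast
  ultimately show ?thesis
    using s unfolding cech_cocycle_def prod.case local_sections_iff by blast
qed

text \<open>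
  On the common refinement by the sets \<open>U a \<inter> V b\<close>, the two systems of sections differ by group
  elements c, which are locally constant and form the 0-cochain that compares the two cocycles.
\<close>

lemma cech_equiv_transition:
  assumes s: "local_sections H E \<phi> I U s" and g: "transition_functions H \<phi> I U s g"
    and t: "local_sections H E \<phi> J V t" and h: "transition_functions H \<phi> J V t h"
  shows "cech_equiv T H (I, U, g) (J, V, h)"
proof -
  have sec: "\<And>a. a \<in> I \<Longrightarrow> smooth_section (U a) (s a)" "\<And>b. b \<in> J \<Longrightarrow> smooth_section (V b) (t b)"
    using s t by (simp_all add: local_sections_iff)
  have "\<forall>a b x. \<exists>c. a \<in> I \<longrightarrow> b \<in> J \<longrightarrow> x \<in> U a \<inter> V b \<longrightarrow> c \<in> carrier H \<and> t b x = \<phi> c (s a x)"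
    using sec smooth_sections_related by metis
  then obtain c' where "\<forall>a b x. a \<in> I \<longrightarrow> b \<in> J \<longrightarrow> x \<in> U a \<inter> V b \<longrightarrow>
      c' a b x \<in> carrier H \<and> t b x = \<phi> (c' a b x) (s a x)"
    by metis
  then have c': "c' a b x \<in> carrier H" "t b x = \<phi> (c' a b x) (s a x)"
    if "a \<in> I" "b \<in> J" "x \<in> U a \<inter> V b" for a b x
    using that by blast+
  have g': "g a b x \<in> carrier H" "s b x = \<phi> (g a b x) (s a x)"
    if "a \<in> I" "b \<in> I" "x \<in> U a \<inter> U b" for a b x
    using g that unfolding transition_functions_def by blast+
  have h': "h a b x \<in> carrier H" "t b x = \<phi> (h a b x) (t a x)"
    if "a \<in> J" "b \<in> J" "x \<in> V a \<inter> V b" for a b x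
    using h that unfolding transition_functions_def by blast+
  define W where "W = (\<lambda>(a, b). U a \<inter> V b)"
  define c where "c = (\<lambda>(a, b). c' a b)"
  show ?thesis
  proof (rule cech_equivI[OF cech_cocycle_transition[OF s g] cech_cocycle_transition[OF t h],
        of "I \<times> J" W fst snd])
    have "(\<Union>k\<in>I \<times> J. W k) = (\<Union>a\<in>I. U a) \<inter> (\<Union>b\<in>J. V b)"
      by (auto simp: W_def)
    then show "open_cover T (I \<times> J) W"
      using s t by (auto simp: local_sections_iff open_cover_def W_def)
    show "refinement (I \<times> J) W I U fst" "refinement (I \<times> J) W J V snd"
      by (auto simp: refinement_def W_def)
    have "locally_constant T (carrier H) (W k) (c k)" if "k \<in> I \<times> J" for k
      using that locally_constant_transition[OF sec(1) sec(2)] c' by (auto simp: W_def c_def)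
    moreover have "h b b' x = g a a' x \<otimes> (c (a', b') x \<otimes> inv (c (a, b) x))"
      if ab: "a \<in> I" "a' \<in> I" "b \<in> J" "b' \<in> J" and x: "x \<in> W (a, b) \<inter> W (a', b')" for a a' b b' x
    proof -
      have x: "x \<in> U a" "x \<in> U a'" "x \<in> V b" "x \<in> V b'" using x by (auto simp: W_def)
      have sE: "s a x \<in> pts E" using sec(1) smooth_section_in ab x by blast
      have mem: "h b b' x \<in> carrier H" "g a a' x \<in> carrier H" "c' a b x \<in> carrier H" "c' a' b' x \<in> carrier H"
        using c' g' h' ab x by blast+
      have "\<phi> (h b b' x \<otimes> c' a b x) (s a x) = \<phi> (h b b' x) (\<phi> (c' a b x) (s a x))"
        by (rule composition_rule[OF sE mem(1,3)])
      also have "\<dots> = t b' x"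
        using c'(2)[OF ab(1,3)] h'(2)[OF ab(3,4)] x by simp
      also have "\<dots> = \<phi> (c' a' b' x) (\<phi> (g a a' x) (s a x))"
        using c'(2)[OF ab(2,4)] g'(2)[OF ab(1,2)] x by simp
      also have "\<dots> = \<phi> (c' a' b' x \<otimes> g a a' x) (s a x)"
        by (rule composition_rule[OF sE mem(4,2), symmetric])
      finally have "h b b' x \<otimes> c' a b x = c' a' b' x \<otimes> g a a' x"
        by (rule action_free[OF sE, rotated 2]) (use mem in auto)
      then have "h b b' x = c' a' b' x \<otimes> g a a' x \<otimes> inv (c' a b x)"
        using mem by (metis inv_solve_right m_closed)
      then show ?thesis
        using mem by (simp add: c_def m_ac)
    qed
    ultimately show "cech_cohomologous T H (I \<times> J) W (\<lambda>k l. g (fst k) (fst l)) (\<lambda>k l. h (snd k) (snd l))"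
      unfolding cech_cohomologous_def by (intro exI[of _ c]) auto
  qed
qed

text \<open>
  Both implications between the two equivalences are transitivity, since the cocycles of any two
  systems of sections are equivalent in either order.
\<close>

lemma cech_class_transition_eq:
  assumes s: "local_sections H E \<phi> I U s" and g: "transition_functions H \<phi> I U s g"
    and t: "local_sections H E \<phi> J V t" and h: "transition_functions H \<phi> J V t h"
  shows "cech_class T H (I, U, g) = cech_class T H (J, V, h)"
proof -
  have "cech_equiv T H (I, U, g) C \<longleftrightarrow> cech_equiv T H (J, V, h) C"
    for C :: "('e set set, 'e set, 'h) cech_family"
  proof (cases C)
    case (fields L W m)
    show ?thesis
      unfolding fields
      using cech_equiv_trans[OF comm_group_axioms cech_equiv_transition[OF s g t h]]
        cech_equiv_trans[OF comm_group_axioms cech_equiv_transition[OF t h s g]]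
      by blast
  qed
  then show ?thesis by (simp add: cech_class_def)
qed

text \<open>
  The index type of the given sections is the one from which the direct limit is formed, so that
  their cocycle is itself a representative of an element of the limit.
\<close>

lemma is_characteristic_class_of_sections:
  fixes I :: "'e set set set"
  assumes s: "local_sections H E \<phi> I U s" and g: "transition_functions H \<phi> I U s g"
  shows "is_characteristic_class TYPE('j) H E \<phi> (cech_class T H (I, U, g))"
  unfolding is_characteristic_class_def
proof (intro conjI allI impI)
  show "cech_class T H (I, U, g) \<in> cech_H1 T H"
    using cech_cocycle_transition[OF s g] unfolding cech_H1_def cech_class_def quotient_def by auto
qed (use s g ex_transition_functions cech_cocycle_transition cech_class_transition_eq in blast)+

lemma ex1_characteristic_class:
  fixes I :: "'e set set set"
  assumes s: "local_sections H E \<phi> I U s"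
  shows "\<exists>!\<alpha>. is_characteristic_class TYPE('e set set) H E \<phi> \<alpha>"
proof -
  obtain g where g: "transition_functions H \<phi> I U s g"
    using ex_transition_functions[OF s] by blast
  show ?thesis
  proof (rule ex1I[of _ "cech_class T H (I, U, g)"])
    show "is_characteristic_class TYPE('e set set) H E \<phi> (cech_class T H (I, U, g))"
      by (rule is_characteristic_class_of_sections[OF s g])
    fix \<alpha> assume "is_characteristic_class TYPE('e set set) H E \<phi> \<alpha>"
    then show "\<alpha> = cech_class T H (I, U, g)"
      using s g unfolding is_characteristic_class_def by blast
  qed
qed

lemma is_characteristic_class_characteristic_class:
  fixes I :: "'e set set set"
  assumes s: "local_sections H E \<phi> I U s"
  shows "is_characteristic_class TYPE('j) H E \<phi> (characteristic_class H E \<phi>)"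
proof -
  obtain g where g: "transition_functions H \<phi> I U s g"
    using ex_transition_functions[OF s] by blast
  have "characteristic_class H E \<phi> = cech_class T H (I, U, g)"
    unfolding characteristic_class_def
    by (rule the1_equality[OF ex1_characteristic_class[OF s]])
      (rule is_characteristic_class_of_sections[OF s g])
  then show ?thesis
    using is_characteristic_class_of_sections[OF s g] by simp
qed

end


section \<open>Coordinates and the action on the spherical space\<close>

lemma equiv_sph_rel: "equiv (sph_families G) (sph_rel G)"
  unfolding equiv_def refl_on_def sym_def trans_def sph_rel_def by fastforce

text \<open>Equivalent families have equal coordinates, so every member of a class gives the same ones.\<close>

definition sph_coord :: "'g sph_family set \<Rightarrow> nat \<Rightarrow> real" where
  "sph_coord c = fst (SOME v. v \<in> c)"

lemma in_sph_class_iff: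
  "w \<in> sph_class G (x, g) \<longleftrightarrow>
     (x, g) \<in> sph_families G \<and> w \<in> sph_families G \<and> fst w = x \<and> (\<forall>i. x i \<noteq> 0 \<longrightarrow> g i = snd w i)"
  by (cases w) (auto simp: sph_class_def sph_rel_def)

lemma sph_class_eqI:
  assumes "(x, g) \<in> sph_families G" "(x, h) \<in> sph_families G" "\<And>i. x i \<noteq> 0 \<Longrightarrow> g i = h i"
  shows "sph_class G (x, g) = sph_class G (x, h)"
  unfolding sph_class_def
  by (rule equiv_class_eq[OF equiv_sph_rel]) (use assms in \<open>simp add: sph_rel_def\<close>)

lemma sph_coord_class:
  assumes "(x, g) \<in> sph_families G"
  shows "sph_coord (sph_class G (x, g)) = x"
proof -
  have "(x, g) \<in> sph_class G (x, g)"
    using assms by (simp add: in_sph_class_iff)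
  then have "(SOME v. v \<in> sph_class G (x, g)) \<in> sph_class G (x, g)"
    by (rule someI)
  from iffD1[OF in_sph_class_iff this] show ?thesis
    unfolding sph_coord_def by (elim conjE)
qed

lemma sph_class_in: "v \<in> sph_families G \<Longrightarrow> sph_class G v \<in> E_sph_set G"
  by (simp add: E_sph_set_def sph_class_def quotientI)

lemma E_sph_set_cases:
  assumes "c \<in> E_sph_set G"
  obtains x g where "(x, g) \<in> sph_families G" "c = sph_class G (x, g)"
  using assms unfolding E_sph_set_def sph_class_def by (elim quotientE) auto

lemma sph_coord_nonzero:
  assumes "c \<in> E_sph_set G"
  shows "\<exists>i. sph_coord c i \<noteq> 0"
proof -
  obtain x g where xg: "(x, g) \<in> sph_families G" "c = sph_class G (x, g)"
    using E_sph_set_cases[OF assms] .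
  then have "(\<Sum>i | x i \<noteq> 0. (x i)\<^sup>2) = 1" by (simp add: sph_families_def)
  then have "{i. x i \<noteq> 0} \<noteq> {}" by (metis sum.empty zero_neq_one)
  then show ?thesis using xg by (auto simp: sph_coord_class)
qed

lemma Z2_simps [simp]: "carrier Z2 = {1, -1}" "a \<otimes>\<^bsub>Z2\<^esub> b = a * b" "\<one>\<^bsub>Z2\<^esub> = 1"
  by (simp_all add: Z2_def)

lemma comm_group_Z2: "comm_group Z2"
  by (rule comm_groupI) auto

lemma sign_family:
  assumes "\<epsilon> \<in> carrier Z2" "(x, g) \<in> sph_families G"
  shows "(\<lambda>i. real_of_int \<epsilon> * x i, g) \<in> sph_families G"
  using assms by (auto simp: sph_families_def)

lemma sph_act_class:
  assumes e: "\<epsilon> \<in> carrier Z2" and xg: "(x, g) \<in> sph_families G"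
  shows "sph_act G \<epsilon> (sph_class G (x, g)) = sph_class G (\<lambda>i. real_of_int \<epsilon> * x i, g)"
proof -
  have "sph_class G (\<lambda>i. real_of_int \<epsilon> * y i, h) = sph_class G (\<lambda>i. real_of_int \<epsilon> * x i, g)"
    if "(y, h) \<in> sph_class G (x, g)" for y h
  proof -
    have "y = x" "(x, h) \<in> sph_families G" "\<forall>i. x i \<noteq> 0 \<longrightarrow> g i = h i"
      using that by (auto simp: in_sph_class_iff)
    then show ?thesis
      unfolding \<open>y = x\<close> using xg by (intro sph_class_eqI sign_family[OF e]) auto
  qed
  moreover have "(x, g) \<in> sph_class G (x, g)"
    using xg by (simp add: in_sph_class_iff)
  ultimately have "(\<Union>(y, h)\<in>sph_class G (x, g). sph_class G (\<lambda>i. real_of_int \<epsilon> * y i, h)) =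
      sph_class G (\<lambda>i. real_of_int \<epsilon> * x i, g)"
    by blast
  then show ?thesis
    using sph_class_in[OF xg] by (simp add: sph_act_def)
qed

lemma sph_act_in:
  assumes "\<epsilon> \<in> carrier Z2" "c \<in> E_sph_set G"
  shows "sph_act G \<epsilon> c \<in> E_sph_set G"
  using E_sph_set_cases[OF assms(2)] sph_act_class[OF assms(1)] sign_family[OF assms(1)] sph_class_in
  by metis

lemma sph_coord_act:
  assumes "\<epsilon> \<in> carrier Z2" "c \<in> E_sph_set G"
  shows "sph_coord (sph_act G \<epsilon> c) i = real_of_int \<epsilon> * sph_coord c i"
  using E_sph_set_cases[OF assms(2)] sph_act_class[OF assms(1)] sign_family[OF assms(1)] sph_coord_class
  by metis

lemma sph_act_mult:
  assumes "\<delta> \<in> carrier Z2" "\<epsilon> \<in> carrier Z2" "c \<in> E_sph_set G"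
  shows "sph_act G (\<delta> * \<epsilon>) c = sph_act G \<delta> (sph_act G \<epsilon> c)"
proof -
  obtain x g where xg: "(x, g) \<in> sph_families G" "c = sph_class G (x, g)"
    using E_sph_set_cases[OF assms(3)] .
  have "\<delta> * \<epsilon> \<in> carrier Z2" using assms by auto
  then show ?thesis
    unfolding xg(2) sph_act_class[OF assms(2) xg(1)]
      sph_act_class[OF assms(1) sign_family[OF assms(2) xg(1)]]
    using xg(1) by (subst sph_act_class) (simp_all add: mult.assoc)
qed

lemma sph_act_one:
  assumes "c \<in> E_sph_set G"
  shows "sph_act G 1 c = c"
proof -
  obtain x g where "(x, g) \<in> sph_families G" "c = sph_class G (x, g)"
    using E_sph_set_cases[OF assms] .
  then show ?thesis using sph_act_class[of 1 x g G] by simp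
qed

lemma group_action_sph_act: "group_action Z2 (E_sph_set G) (sph_act G)"
proof -
  interpret Z2: comm_group Z2 by (rule comm_group_Z2)
  have bij: "sph_act G \<epsilon> \<in> Bij (E_sph_set G)" if e: "\<epsilon> \<in> carrier Z2" for \<epsilon>
  proof -
    have "sph_act G \<epsilon> (sph_act G \<epsilon> c) = c" if "c \<in> E_sph_set G" for c
      using e that sph_act_mult[OF e e that] sph_act_one[OF that] by auto
    then have "bij_betw (sph_act G \<epsilon>) (E_sph_set G) (E_sph_set G)"
      using sph_act_in[OF e] by (intro bij_betwI[where g = "sph_act G \<epsilon>"]) auto
    then show ?thesis
      by (simp add: Bij_def sph_act_def)
  qed
  have "sph_act G (\<delta> \<otimes>\<^bsub>Z2\<^esub> \<epsilon>) = sph_act G \<delta> \<otimes>\<^bsub>BijGroup (E_sph_set G)\<^esub> sph_act G \<epsilon>"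
    if "\<delta> \<in> carrier Z2" "\<epsilon> \<in> carrier Z2" for \<delta> \<epsilon>
  proof
    fix c
    show "sph_act G (\<delta> \<otimes>\<^bsub>Z2\<^esub> \<epsilon>) c = (sph_act G \<delta> \<otimes>\<^bsub>BijGroup (E_sph_set G)\<^esub> sph_act G \<epsilon>) c"
    proof (cases "c \<in> E_sph_set G")
      case True
      then show ?thesis
        using that sph_act_mult[OF that True] bij by (simp add: BijGroup_def compose_eq)
    next
      case False
      then show ?thesis
        using that bij by (simp add: BijGroup_def compose_def sph_act_def)
    qed
  qed
  then have "group_hom Z2 (BijGroup (E_sph_set G)) (sph_act G)"
    using bij group_BijGroup Z2.group_axioms
    by (intro group_hom.intro group_hom_axioms.intro homI) (simp_all add: BijGroup_def)
  then show ?thesis by (rule group_action.intro)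
qed

text \<open>A sign that fixes a class fixes a nonzero coordinate of it.\<close>

lemma sph_act_free:
  assumes "c \<in> E_sph_set G" "\<epsilon> \<in> carrier Z2" "sph_act G \<epsilon> c = c"
  shows "\<epsilon> = 1"
proof -
  obtain i where "sph_coord c i \<noteq> 0" using sph_coord_nonzero[OF assms(1)] by blast
  moreover have "real_of_int \<epsilon> * sph_coord c i = sph_coord c i"
    using sph_coord_act[OF assms(2,1), of i] assms(3) by simp
  ultimately show ?thesis by simp
qed


section \<open>The diffeology of the spherical space\<close>

definition chart_dspace :: "'g dspace \<Rightarrow> nat set \<Rightarrow> ((nat \<Rightarrow> real) \<times> (nat \<Rightarrow> 'g)) dspace" where
  "chart_dspace D I = prod_dspace (sphere_dspace I) (power_dspace I D)"

lemma E_sph_eq: "E_sph G D = final_dspace (E_sph_set G) {I. finite I} (chart_dspace D) (\<psi> G)"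
  unfolding E_sph_def chart_dspace_def ..

lemma pts_chart_dspace:
  "pts (chart_dspace D I) =
     {x \<in> I \<rightarrow>\<^sub>E UNIV. (\<Sum>i\<in>I. (x i)\<^sup>2) = 1} \<times> (I \<rightarrow>\<^sub>E pts D)"
  by (auto simp: chart_dspace_def sphere_dspace_def subset_dspace_def power_dspace_def real_dspace_def)

lemma plot_chart_dspace_iff:
  "plot (chart_dspace D I) n U p \<longleftrightarrow> openin (Euclidean_space n) U \<and>
     p \<in> U \<rightarrow> pts (chart_dspace D I) \<and>
     (\<forall>i\<in>I. smooth_fun n U (\<lambda>u. fst (p u) i) \<and> plot D n U (\<lambda>u. snd (p u) i))"
  by (auto simp: pts_chart_dspace chart_dspace_def plot_prod_dspace_iff sphere_dspace_def subset_dspace_def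
      power_dspace_def real_dspace_def Pi_iff mem_Times_iff)

lemma psi_family:
  assumes "finite I" "(x, g) \<in> pts (chart_dspace D I)" "pts D = carrier G" "group G"
  shows "(\<lambda>i. if i \<in> I then x i else 0, \<lambda>i. if i \<in> I then g i else \<one>\<^bsub>G\<^esub>) \<in> sph_families G"
proof -
  interpret group G by (rule assms(4))
  let ?x = "\<lambda>i. if i \<in> I then x i else 0"
  have supp: "{i. ?x i \<noteq> 0} \<subseteq> I" by auto
  have "(\<Sum>i | ?x i \<noteq> 0. (?x i)\<^sup>2) = (\<Sum>i\<in>I. (?x i)\<^sup>2)"
    by (rule sum.mono_neutral_left[OF assms(1) supp]) auto
  also have "\<dots> = (\<Sum>i\<in>I. (x i)\<^sup>2)" by simp
  also have "\<dots> = 1" using assms(2) by (simp add: pts_chart_dspace)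
  finally have "(\<Sum>i | ?x i \<noteq> 0. (?x i)\<^sup>2) = 1" .
  then show ?thesis
    using finite_subset[OF supp assms(1)] assms(2,3) by (auto simp: sph_families_def pts_chart_dspace)
qed

locale spherical_space =
  fixes G :: "('g, 'm) monoid_scheme" and D :: "'g dspace"
  assumes diffeological_group: "diffeological_group G D"
begin

lemma grp: "group G" and pts_D: "pts D = carrier G"
  using diffeological_group by (simp_all add: diffeological_group_def)

abbreviation "E \<equiv> E_sph G D"

lemma pts_E [simp]: "pts E = E_sph_set G"
  by (simp add: E_sph_eq)

lemma psi_in: "finite I \<Longrightarrow> \<psi> G I \<in> pts (chart_dspace D I) \<rightarrow> E_sph_set G"
  by (auto simp: \<psi>_def intro!: sph_class_in psi_family[OF _ _ pts_D grp])

lemma sph_coord_psi: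
  assumes "finite I" "v \<in> pts (chart_dspace D I)"
  shows "sph_coord (\<psi> G I v) i = (if i \<in> I then fst v i else 0)"
proof (cases v)
  case (Pair x g)
  then show ?thesis
    using sph_coord_class[OF psi_family[OF assms(1) _ pts_D grp, of x g]] assms(2)
    by (simp add: \<psi>_def)
qed

text \<open>
  The action lifts to the maps \<open>\<psi> G I\<close>. The lift is restricted to I because the points of a power
  are extensional functions.
\<close>

lemma sph_act_psi:
  assumes "finite I" "v \<in> pts (chart_dspace D I)" "\<epsilon> \<in> carrier Z2"
  shows "sph_act G \<epsilon> (\<psi> G I v) = \<psi> G I (\<lambda>i\<in>I. real_of_int \<epsilon> * fst v i, snd v)"
proof (cases v)
  case (Pair x g)
  have "(\<lambda>i. real_of_int \<epsilon> * (if i \<in> I then x i else 0)) =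
      (\<lambda>i. if i \<in> I then (\<lambda>i\<in>I. real_of_int \<epsilon> * x i) i else 0)"
    by auto
  then show ?thesis
    using sph_act_class[OF assms(3) psi_family[OF assms(1) _ pts_D grp, of x g]] assms(2) Pair
    by (simp add: \<psi>_def del: Z2_simps)
qed

lemma diffeological_E: "diffeological_space E"
  unfolding E_sph_eq
  by (rule diffeological_final_dspace) (use psi_in in \<open>simp_all add: plot_chart_dspace_iff\<close>)

lemma plot_psi:
  assumes "finite I" "plot (chart_dspace D I) n U p"
  shows "plot E n U (\<lambda>u. \<psi> G I (p u))"
proof -
  have "smooth_map (chart_dspace D I) E (\<psi> G I)"
    unfolding E_sph_eq
    by (rule smooth_map_into_final) (use assms psi_in in auto)
  then show ?thesis using assms(2) by (rule smooth_map_plot)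
qed

lemma smooth_map_from_E:
  assumes Z: "diffeological_space Z" and f: "f \<in> E_sph_set G \<rightarrow> pts Z"
    and plots: "\<And>I n U p. finite I \<Longrightarrow> plot (chart_dspace D I) n U p \<Longrightarrow> plot Z n U (\<lambda>u. f (\<psi> G I (p u)))"
  shows "smooth_map E Z f"
  unfolding E_sph_eq
proof (rule smooth_map_from_final[OF Z f])
  fix I :: "nat set" assume "I \<in> {I. finite I}"
  then have I: "finite I" by simp
  then show psi: "\<psi> G I \<in> pts (chart_dspace D I) \<rightarrow> E_sph_set G" by (rule psi_in)
  show "smooth_map (chart_dspace D I) Z (\<lambda>v. f (\<psi> G I v))"
    unfolding smooth_map_def using plots[OF I] f psi by (auto simp: o_def)
qed (simp add: plot_chart_dspace_iff)

lemma smooth_sph_act: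
  assumes e: "\<epsilon> \<in> carrier Z2"
  shows "smooth_map E E (sph_act G \<epsilon>)"
proof (rule smooth_map_from_E[OF diffeological_E])
  show "sph_act G \<epsilon> \<in> E_sph_set G \<rightarrow> pts E" using sph_act_in[OF e] by auto
  fix I n U p assume I: "finite I" and p: "plot (chart_dspace D I) n U p"
  let ?q = "\<lambda>u. (\<lambda>i\<in>I. real_of_int \<epsilon> * fst (p u) i, snd (p u))"
  have pu: "p u \<in> pts (chart_dspace D I)" if "u \<in> U" for u
    using p that unfolding plot_chart_dspace_iff by blast
  have "?q u \<in> pts (chart_dspace D I)" if "u \<in> U" for u
    using pu[OF that] e by (auto simp: pts_chart_dspace)
  moreover have "smooth_fun n U (\<lambda>u. (\<lambda>i\<in>I. real_of_int \<epsilon> * fst (p u) i) i)" if "i \<in> I" for i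
  proof -
    have "smooth_fun n U (\<lambda>u. fst (p u) i)"
      using p that unfolding plot_chart_dspace_iff by blast
    then show ?thesis
      using e that C_diff_minus by (auto simp: smooth_fun_def)
  qed
  ultimately have "plot (chart_dspace D I) n U ?q"
    using p unfolding plot_chart_dspace_iff by (auto)
  then have "plot E n U (\<lambda>u. \<psi> G I (?q u))"
    by (rule plot_psi[OF I])
  then show "plot E n U (\<lambda>u. sph_act G \<epsilon> (\<psi> G I (p u)))"
    by (rule plot_cong[OF diffeological_E]) (simp add: sph_act_psi[OF I pu e])
qed

text \<open>
  On the domain of \<open>\<psi> G I\<close> the i-th coordinate is a coordinate function of the sphere, or 0 if i is not
  in I; the universal property of the final diffeology transfers continuity to all plots.
\<close>

lemma continuous_sph_coord:
  assumes "plot E n U p"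
  shows "continuous_map (subtopology (Euclidean_space n) U) euclideanreal (\<lambda>u. sph_coord (p u) i)"
proof -
  have "smooth_map E (continuous_dspace euclideanreal) (\<lambda>c. sph_coord c i)"
  proof (rule smooth_map_from_E[OF diffeological_continuous_dspace])
    fix I n U p assume I: "finite I" and p: "plot (chart_dspace D I) n U p"
    have pu: "p u \<in> pts (chart_dspace D I)" if "u \<in> U" for u
      using p that unfolding plot_chart_dspace_iff by blast
    have "continuous_map (subtopology (Euclidean_space n) U) euclideanreal
        (\<lambda>u. if i \<in> I then fst (p u) i else 0)"
    proof (cases "i \<in> I")
      case True
      then have "smooth_fun n U (\<lambda>u. fst (p u) i)"
        using p unfolding plot_chart_dspace_iff by blast
      then show ?thesis
        using True C_diff_continuous by (auto simp: smooth_fun_def)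
    qed simp
    then have "plot (continuous_dspace euclideanreal) n U (\<lambda>u. if i \<in> I then fst (p u) i else 0)"
      using p unfolding plot_chart_dspace_iff continuous_dspace_def by simp
    then show "plot (continuous_dspace euclideanreal) n U (\<lambda>u. sph_coord (\<psi> G I (p u)) i)"
      by (rule plot_cong[OF diffeological_continuous_dspace]) (simp add: sph_coord_psi[OF I pu])
  qed simp
  from smooth_map_plot[OF this assms] show ?thesis
    by (simp add: continuous_dspace_def)
qed

lemma openin_sph_coord:
  assumes "plot E n U p" "open S"
  shows "openin (Euclidean_space n) {u \<in> U. sph_coord (p u) i \<in> S}"
  using continuous_sph_coord[OF assms(1)] assms(2)
  unfolding continuous_map_open_subtopology_iff[OF plot_openin[OF diffeological_E assms(1)]] by simp

text \<open>
  If \<open>q = h p\<close> with signs h, then \<open>x_i(p) x_i(q) = h x_i(p)^2\<close>, so the product of the i-th coordinates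
  has sign h wherever \<open>x_i\<close> does not vanish; and at every point some coordinate does not vanish.
\<close>

lemma plot_sign:
  assumes p: "plot E n U p" and q: "plot E n U q"
    and h: "\<And>u. u \<in> U \<Longrightarrow> h u \<in> carrier Z2 \<and> q u = sph_act G (h u) (p u)"
  shows "plot (discrete_dspace (carrier Z2)) n U h"
proof -
  have U: "openin (Euclidean_space n) U" using plot_openin[OF diffeological_E p] .
  have "openin (Euclidean_space n) {u \<in> U. h u = a}" if a: "a \<in> carrier Z2" for a
  proof -
    let ?f = "\<lambda>i u. real_of_int a * (sph_coord (p u) i * sph_coord (q u) i)"
    have cont: "continuous_map (subtopology (Euclidean_space n) U) euclideanreal (?f i)" for i
      by (intro continuous_map_real_mult continuous_sph_coord[OF p] continuous_sph_coord[OF q]) simp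
    have op: "openin (Euclidean_space n) {u \<in> U. ?f i u \<in> {0<..}}" for i
      by (rule iffD1[OF continuous_map_open_subtopology_iff[OF U] cont, THEN conjunct2, rule_format])
        (simp only: open_openin[symmetric] open_greaterThan)
    have "(\<exists>i. ?f i u \<in> {0<..}) \<longleftrightarrow> h u = a" if u: "u \<in> U" for u
    proof -
      have pu: "p u \<in> E_sph_set G" using plot_in_pts[OF diffeological_E p u] by simp
      have f: "?f i u = real_of_int (a * h u) * (sph_coord (p u) i)\<^sup>2" for i
        using h[OF u] sph_coord_act[OF _ pu] by (simp add: power2_eq_square)
      obtain i where "sph_coord (p u) i \<noteq> 0" using sph_coord_nonzero[OF pu] by blast
      then have "h u = a \<Longrightarrow> ?f i u \<in> {0<..}"
        unfolding f using a by auto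
      moreover have "h u = a" if "?f j u \<in> {0<..}" for j
        using that a h[OF u] unfolding f by (auto simp: mult_less_0_iff not_less[symmetric])
      ultimately show ?thesis by blast
    qed
    then have "{u \<in> U. h u = a} = (\<Union>i. {u \<in> U. ?f i u \<in> {0<..}})" by blast
    then show ?thesis using op by auto
  qed
  then show ?thesis
    using U h unfolding plot_discrete_dspace_iff by blast
qed

lemma principal_bundle_E: "principal_bundle Z2 (discrete_dspace (carrier Z2)) E (sph_act G)"
proof (rule principal_bundle_discreteI)
  show "group Z2" using comm_group_Z2 by (rule comm_group.axioms)
  show "group_action Z2 (pts E) (sph_act G)" by (simp add: group_action_sph_act)
  show "diffeological_space E" by (rule diffeological_E)
  show "smooth_map E E (sph_act G h)" if "h \<in> carrier Z2" for h
    using that by (rule smooth_sph_act)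
  show "h = \<one>\<^bsub>Z2\<^esub>" if "x \<in> pts E" "h \<in> carrier Z2" "sph_act G h x = x" for x h
    using that sph_act_free by (simp del: Z2_simps(1))
qed (rule plot_sign)

sublocale sph_bundle: discrete_principal_bundle Z2 E "sph_act G"
  by (intro discrete_principal_bundle.intro discrete_principal_bundle_axioms.intro
      comm_group_Z2 principal_bundle_E)


section \<open>Local sections normalising the sign of one coordinate\<close>

text \<open>The sign of a coordinate depends on the choice of a point of the orbit, its vanishing does not.\<close>

definition coord_nonzero :: "nat \<Rightarrow> 'g sph_family set set set" where
  "coord_nonzero i = {orbit Z2 (sph_act G) c | c. c \<in> E_sph_set G \<and> sph_coord c i \<noteq> 0}"

definition positive_lift :: "nat \<Rightarrow> 'g sph_family set set \<Rightarrow> 'g sph_family set" where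
  "positive_lift i X = (THE c. c \<in> X \<and> sph_coord c i > 0)"

lemma in_orbit_iff:
  "d \<in> orbit Z2 (sph_act G) c \<longleftrightarrow> (\<exists>\<epsilon>\<in>carrier Z2. d = sph_act G \<epsilon> c)"
  by (auto simp: orbit_def)

lemma orbit_in_coord_nonzero_iff:
  assumes c: "c \<in> E_sph_set G"
  shows "orbit Z2 (sph_act G) c \<in> coord_nonzero i \<longleftrightarrow> sph_coord c i \<noteq> 0"
proof
  assume "orbit Z2 (sph_act G) c \<in> coord_nonzero i"
  then obtain d where d: "d \<in> E_sph_set G" "sph_coord d i \<noteq> 0"
      "orbit Z2 (sph_act G) c = orbit Z2 (sph_act G) d"
    by (auto simp: coord_nonzero_def)
  then have "c \<in> orbit Z2 (sph_act G) d"
    using sph_bundle.orbit_refl[of c] c d(3) by simp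
  then show "sph_coord c i \<noteq> 0"
    using d sph_coord_act[OF _ d(1)] by (auto simp: in_orbit_iff)
qed (use c in \<open>auto simp: coord_nonzero_def\<close>)

lemma positive_lift_orbit:
  assumes c: "c \<in> E_sph_set G" and i: "sph_coord c i \<noteq> 0"
  shows "positive_lift i (orbit Z2 (sph_act G) c) = sph_act G (if sph_coord c i > 0 then 1 else -1) c"
  unfolding positive_lift_def
proof (rule the_equality)
  show "sph_act G (if sph_coord c i > 0 then 1 else -1) c \<in> orbit Z2 (sph_act G) c \<and>
      0 < sph_coord (sph_act G (if sph_coord c i > 0 then 1 else -1) c) i"
    using i by (auto simp: in_orbit_iff sph_coord_act[OF _ c])
  fix d assume "d \<in> orbit Z2 (sph_act G) c \<and> 0 < sph_coord d i"
  then show "d = sph_act G (if sph_coord c i > 0 then 1 else -1) c"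
    by (auto simp: in_orbit_iff sph_coord_act[OF _ c])
qed

lemma plot_base_lift:
  assumes "plot sph_bundle.B n P p" "u \<in> P"
  obtains V q where "u \<in> V" "V \<subseteq> P" "plot E n V q" "\<And>v. v \<in> V \<Longrightarrow> p v = orbit Z2 (sph_act G) (q v)"
proof (rule plot_final_surj_lift[OF diffeological_E _ _ assms(2)])
  show "plot (final_dspace (orbits Z2 (pts E) (sph_act G)) {()} (\<lambda>_. E) (\<lambda>_. orbit Z2 (sph_act G))) n P p"
    using assms(1) by (simp add: quotient_dspace_def)
qed (auto simp: orbits_def that)

text \<open>
  The D-topology is tested on plots of the quotient. Locally these lift to plots q of the total space,
  along which the i-th coordinate is continuous.
\<close>

lemma openin_coord_nonzero: "openin sph_bundle.T (coord_nonzero i)"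
  unfolding openin_D_topology
proof (intro conjI allI impI)
  show "coord_nonzero i \<subseteq> pts sph_bundle.B"
    by (auto simp: coord_nonzero_def quotient_dspace_def orbits_def)
  fix n P p assume p: "plot sph_bundle.B n P p"
  show "openin (Euclidean_space n) {u \<in> P. p u \<in> coord_nonzero i}"
  proof (subst openin_subopen, intro ballI)
    fix u assume u: "u \<in> {u \<in> P. p u \<in> coord_nonzero i}"
    then obtain V q where V: "u \<in> V" "V \<subseteq> P" and q: "plot E n V q"
      and pq: "\<And>v. v \<in> V \<Longrightarrow> p v = orbit Z2 (sph_act G) (q v)"
      using plot_base_lift[OF p] by blast
    have "p v \<in> coord_nonzero i \<longleftrightarrow> sph_coord (q v) i \<in> - {0}" if "v \<in> V" for v
      using orbit_in_coord_nonzero_iff plot_in_pts[OF diffeological_E q that] pq[OF that] by simp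
    then have "{v \<in> V. p v \<in> coord_nonzero i} = {v \<in> V. sph_coord (q v) i \<in> - {0}}"
      by blast
    then have "openin (Euclidean_space n) {v \<in> V. p v \<in> coord_nonzero i}"
      by (simp only: openin_sph_coord[OF q open_Compl[OF closed_singleton]])
    then show "\<exists>W. openin (Euclidean_space n) W \<and> u \<in> W \<and> W \<subseteq> {u \<in> P. p u \<in> coord_nonzero i}"
      using u V by (intro exI[of _ "{v \<in> V. p v \<in> coord_nonzero i}"]) auto
  qed
qed

text \<open>
  On a local lift q of a plot, the section multiplies q by the sign of its i-th coordinate. Since this
  coordinate has no zeros, the sign is locally constant, so the product is again a plot.
\<close>

lemma smooth_section_positive_lift: "sph_bundle.smooth_section (coord_nonzero i) (positive_lift i)"
proof -
  have lift: "positive_lift i X \<in> E_sph_set G \<and> orbit Z2 (sph_act G) (positive_lift i X) = X"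
    if X: "X \<in> coord_nonzero i" for X
  proof -
    obtain c where c: "c \<in> E_sph_set G" "sph_coord c i \<noteq> 0" and [simp]: "X = orbit Z2 (sph_act G) c"
      using X by (auto simp: coord_nonzero_def)
    show ?thesis
      using c by (simp add: positive_lift_orbit sph_act_in sph_bundle.orbit_translate)
  qed
  have "smooth_map (subset_dspace sph_bundle.B (coord_nonzero i)) E (positive_lift i)"
    unfolding smooth_map_def
  proof (intro conjI allI impI)
    show "positive_lift i \<in> pts (subset_dspace sph_bundle.B (coord_nonzero i)) \<rightarrow> pts E"
      using lift by (auto simp: subset_dspace_def)
    fix n P p assume "plot (subset_dspace sph_bundle.B (coord_nonzero i)) n P p"
    then have p: "plot sph_bundle.B n P p" and nz: "\<And>u. u \<in> P \<Longrightarrow> p u \<in> coord_nonzero i"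
      by (auto simp: subset_dspace_def)
    show "plot E n P (positive_lift i \<circ> p)"
    proof (rule plot_local[OF diffeological_E plot_openin[OF sph_bundle.diffeological_base p]])
      fix u assume "u \<in> P"
      then obtain V q where V: "u \<in> V" "V \<subseteq> P" and q: "plot E n V q"
        and pq: "\<And>v. v \<in> V \<Longrightarrow> p v = orbit Z2 (sph_act G) (q v)"
        using plot_base_lift[OF p] by blast
      let ?sgn = "\<lambda>v. if sph_coord (q v) i > 0 then 1 else - 1 :: int"
      have qE: "q v \<in> E_sph_set G" if "v \<in> V" for v
        using plot_in_pts[OF diffeological_E q that] by simp
      have qnz: "sph_coord (q v) i \<noteq> 0" if "v \<in> V" for v
        using orbit_in_coord_nonzero_iff[OF qE[OF that]] nz pq V that by (metis subsetD)
      have "{v \<in> V. ?sgn v = 1} = {v \<in> V. sph_coord (q v) i \<in> {0<..}}"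
        "{v \<in> V. ?sgn v = - 1} = {v \<in> V. sph_coord (q v) i \<in> {..<0}}"
        using qnz by force+
      then have "plot (discrete_dspace (carrier Z2)) n V ?sgn"
        using plot_openin[OF diffeological_E q] openin_sph_coord[OF q, of "{0<..}" i]
          openin_sph_coord[OF q, of "{..<0}" i]
        by (simp add: plot_discrete_dspace_iff)
      then have "plot (prod_dspace (discrete_dspace (carrier Z2)) E) n V (\<lambda>v. (?sgn v, q v))"
        using q by (simp add: plot_prod_dspace_iff)
      moreover have "smooth_map (prod_dspace (discrete_dspace (carrier Z2)) E) E (\<lambda>(h, c). sph_act G h c)"
        by (intro smooth_map_discrete_prod diffeological_E smooth_sph_act)
      ultimately have "plot E n V (\<lambda>v. sph_act G (?sgn v) (q v))"
        using smooth_map_plot by fastforce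
      then have "plot E n V (positive_lift i \<circ> p)"
        by (rule plot_cong[OF diffeological_E]) (simp add: pq positive_lift_orbit qE qnz)
      then show "\<exists>V. u \<in> V \<and> V \<subseteq> P \<and> plot E n V (positive_lift i \<circ> p)"
        using V by blast
    qed
  qed
  then show ?thesis
    using openin_coord_nonzero lift by (simp add: sph_bundle.smooth_section_def)
qed

text \<open>
  A point of the sphere has a nonzero coordinate, so the sets \<open>coord_nonzero i\<close> cover the quotient. The
  cover is indexed by its own members because the elements of the first cohomology are represented by
  cocycles on covers indexed by sets of points.
\<close>

lemma ex_local_sections:
  "\<exists>(I :: 'g sph_family set set set set) U s. local_sections Z2 E (sph_act G) I U s"
proof -
  let ?I = "range coord_nonzero"
  let ?s = "\<lambda>A. positive_lift (SOME i. A = coord_nonzero i)"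
  have "sph_bundle.smooth_section A (?s A)" if "A \<in> ?I" for A
  proof -
    have "A = coord_nonzero (SOME i. A = coord_nonzero i)"
      by (rule someI_ex) (use that in blast)
    then show ?thesis
      using smooth_section_positive_lift[of "SOME i. A = coord_nonzero i"] by simp
  qed
  moreover have "open_cover sph_bundle.T ?I (\<lambda>A. A)"
  proof -
    have "X \<in> (\<Union>i. coord_nonzero i)" if X: "X \<in> topspace sph_bundle.T" for X
    proof -
      have "X \<in> pts sph_bundle.B"
        using X openin_topspace[of sph_bundle.T] unfolding openin_D_topology by blast
      then obtain c where c: "c \<in> E_sph_set G" "X = orbit Z2 (sph_act G) c"
        by (auto simp: quotient_dspace_def orbits_def)
      obtain i where "sph_coord c i \<noteq> 0"
        using sph_coord_nonzero[OF c(1)] by blast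
      then have "X \<in> coord_nonzero i"
        by (simp add: c orbit_in_coord_nonzero_iff)
      then show ?thesis by blast
    qed
    then have "topspace sph_bundle.T \<subseteq> (\<Union>i. coord_nonzero i)"
      by (rule subsetI)
    moreover have "(\<Union>i. coord_nonzero i) \<subseteq> topspace sph_bundle.T"
      by (intro UN_least openin_subset openin_coord_nonzero)
    ultimately show ?thesis
      unfolding open_cover_def by (simp add: openin_coord_nonzero set_eq_subset)
  qed
  ultimately have "local_sections Z2 E (sph_act G) ?I (\<lambda>A. A) ?s"
    by (simp add: sph_bundle.local_sections_iff)
  then show ?thesis by blast
qed

end

theorem theorem4p6:
  fixes G :: "('g, 'm) monoid_scheme" and D :: "'g dspace"
  assumes "diffeological_group G D"
  shows "principal_bundle Z2 (discrete_dspace (carrier Z2)) (E_sph G D) (sph_act G) \<and>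
    (\<exists>(I :: 'g sph_family set set set set) U s.
       local_sections Z2 (E_sph G D) (sph_act G) I U s) \<and>
    (\<exists>!\<alpha>. is_characteristic_class TYPE('g sph_family set set set)
       Z2 (E_sph G D) (sph_act G) \<alpha>) \<and>
    alpha_sph G D \<in> cech_H1 (D_topology (E_proj G D)) Z2 \<and>
    is_characteristic_class TYPE('j) Z2 (E_sph G D) (sph_act G) (alpha_sph G D)"
proof -
  interpret spherical_space G D by (rule spherical_space.intro) (rule assms)
  obtain I :: "'g sph_family set set set set" and U s
    where s: "local_sections Z2 (E_sph G D) (sph_act G) I U s"
    using ex_local_sections by blast
  have alpha: "is_characteristic_class TYPE('j) Z2 (E_sph G D) (sph_act G) (alpha_sph G D)"
    unfolding alpha_sph_def by (rule sph_bundle.is_characteristic_class_characteristic_class[OF s])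
  then have "alpha_sph G D \<in> cech_H1 (D_topology (E_proj G D)) Z2"
    by (simp add: is_characteristic_class_def E_proj_def)
  then show ?thesis
    using principal_bundle_E ex_local_sections sph_bundle.ex1_characteristic_class[OF s] alpha by blast
qed

end
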